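(* Let $\eta$ be a non-periodic Toeplitz sequence with period structure $(p_n)_{n\ge1}$. Assume that for every $n\in\mathbb N$ there is a primitive set $A_n$ of positive integers and, for each $a\in A_n$, a set $S_n(a)$ of positive integers such that $$\widetilde{\mathcal H}_n=\bigcup_{a\in A_n}\bigl(a\mathbb Z\setminus\mathcal M_{S_n(a)}\bigr)\quad\text{and}\quad a\mathbb Z\setminus\mathcal M_{S_n(a)}\ne\emptyset\ \ (a\in A_n).$$ Assume further that for all choices of $a_n\in A_n$ ($n\in\mathbb N$), $$\lim_{n\to\infty}\ \sum_{a'\in A_n\setminus\{a_n\}}\frac1{\varphi\bigl(a'/\gcd(a',a_n)\bigr)}=0 .$$ Let the automorphism $F$ of $(X_\eta,\sigma)$ be described by a block code $\{0,1\}^{[-m:m]}\to\{0,1\}$, and let $K$ be the associated set of integers (defined in the context). Then: (a) For each $n>0$ and each $k\in K$ there exists $a\in A_n$ such that $a\mid (y_F)_n-k$. (b) For each $n>0$ and each $a\in A_n$ there exists some $k\in K$ such that $a\mid(y_F)_n-k$. If $a>2m$, then this $k\in K$ is unique; denote it by $\kappa_n(a)$. (c) Suppose $n$ is so large that $\min A_n>2m$, and let $\mathcal G_n$ be the graph with vertex set $A_n$ and edges $(a,a')$ whenever $\gcd(a,a')>2m$. Then $\kappa_n(a)=\kappa_n(a')$ for any two $a,a'$ in the same connected component of $\mathcal G_n$. In particular, $|K|=1$ if $\mathcal G_n$ is connected. (d) If $|K|=1$, say $K=\{k\}$, then, for each $n$, $(y_F)_n-k$ is a multiple of the minimal period $\tilde\tau_n$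 of $\widetilde{\mathcal H}_n$. (e) If $|K|=1$ for (the set $K$ associated to) every automorphism $F$ of $(X_\eta,\sigma)$, and $\tilde\tau_n=p_n$ for all $n$, then $(X_\eta,\sigma)$ has a trivial centralizer.
   Context: $\mathbb N=\{1,2,\dots\}$; $\varphi$ is Euler's totient function. For a set $A$ of positive integers, $\mathcal M_A=\bigcup_{a\in A}a\mathbb Z$; $A$ is primitive if no element divides a different element. A non-periodic Toeplitz sequence with period structure $p_1\mid p_2\mid\dots\to\infty$ is a non-periodic $\eta\in\{0,1\}^{\mathbb Z}$ such that for each $k\in\mathbb Z$ there is $n\ge1$ with $\eta|_{k+p_n\mathbb Z}$ constant. $\sigma$ is the left shift and $X_\eta$ the orbit closure of $\eta$. For $i=0,1$: $\mathcal P_n^i=\{k\in\mathbb Z:\eta|_{k+p_n\mathbb Z}=i\}$; $\mathcal H_n=\mathbb Z\setminus(\mathcal P_n^0\cup\mathcal P_n^1)$ (holes at level $n$); essential holes: $\widetilde{\mathcal H}_N=\{k\in\mathcal H_N:\mathcal H_n\cap(k+p_N\mathbb Z)\neq\emptyset\ \forall n\ge N\}$, with minimal period $\tilde\tau_N\mid p_N$. $G=\varprojlim\mathbb Z/p_n\mathbb Z$; $\Delta(k)=(k+p_n\mathbb Z)_n$; $Tg=g+\Delta(1)$; $U_n(h)=\{g\in G:g_n=h_n\}$; $V^i=\bigcup_{n}\bigcup_{k\in\mathcal P_n^i\cap[0,p_n)}U_n(\Delta(k))$; $W=\overline{V^1}=G\setminus V^0$ with boundary $\partial W=G\setminus(V^0\cup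 V^1)$. Standing assumption: $(G,T)$ is the maximal equicontinuous factor of $(X_\eta,\sigma)$, with factor map $\pi$ determined by $\pi(\eta)=\Delta(0)$. An automorphism is a homeomorphism $F$ of $X_\eta$ commuting with $\sigma$; $y_F\in G$ is the unique element with $\pi(F(x))=\pi(x)+y_F$ for all $x$. The group of all automorphisms is the centralizer; it is trivial if it consists only of powers of $\sigma$. $F$ is described by a block code $c:\{0,1\}^{[-m:m]}\to\{0,1\}$ if $(Fx)_s=c(x_{s-m},\dots,x_{s+m})$ for all $x\in X_\eta$, $s\in\mathbb Z$. For $k\in\mathbb Z$ let $V_k=\partial W\cap(\partial W+\Delta(k)-y_F)$ and $K=\{k\in\mathbb Z:\operatorname{int}_{\partial W}(V_k)\ne\emptyset\}$, where $\operatorname{int}_{\partial W}$ is the interior in the subspace topology of $\partial W$. Convention: an integer $t$ divides $z\in\mathbb Z/p_n\mathbb Z$ if $z\in t\cdot(\mathbb Z/p_n\mathbb Z)$. *)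

theory Defs
  imports "HOL-Analysis.Analysis" "HOL-Number_Theory.Totient"
begin

section \<open>Topological dynamical systems\<close>

definition dynamical_system :: "'a topology \<Rightarrow> ('a \<Rightarrow> 'a) \<Rightarrow> bool" where
  "dynamical_system X S \<longleftrightarrow>
     compact_space X \<and> metrizable_space X \<and> homeomorphic_map X X S"

text \<open>Equicontinuity of the family of all iterates \<open>S^n\<close>, \<open>n\<close> an integer. On a compact space the
  choice of the metric inducing the topology is irrelevant.\<close>

definition equicontinuous_system :: "'a topology \<Rightarrow> ('a \<Rightarrow> 'a) \<Rightarrow> bool" where
  "equicontinuous_system X S \<longleftrightarrow>
     dynamical_system X S \<and>
     (\<exists>M d. Metric_space M d \<and> Metric_space.mtopology M d = X \<and>
       (\<forall>\<epsilon>>0. \<exists>\<delta>>0. \<forall>x\<in>M. \<forall>y\<in>M. d x y < \<delta> \<longrightarrow>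
          (\<forall>n. d ((S ^^ n) x) ((S ^^ n) y) < \<epsilon> \<and>
               d ((inv_into M S ^^ n) x) ((inv_into M S ^^ n) y) < \<epsilon>)))"

definition factor_map ::
  "'a topology \<Rightarrow> ('a \<Rightarrow> 'a) \<Rightarrow> 'b topology \<Rightarrow> ('b \<Rightarrow> 'b) \<Rightarrow> ('a \<Rightarrow> 'b) \<Rightarrow> bool" where
  "factor_map X S Y R \<rho> \<longleftrightarrow>
     continuous_map X Y \<rho> \<and> \<rho> ` topspace X = topspace Y \<and>
     (\<forall>x\<in>topspace X. \<rho> (S x) = R (\<rho> x))"

text \<open>Every equicontinuous factor of \<open>(X, S)\<close> factors through \<open>\<pi>\<close>. Letting the competing factors
  \<open>(Z, Q)\<close> range over systems whose points are of type \<^typ>\<open>'a\<close> is no restriction: choosing a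
  point in each fibre of a factor map transports any factor of \<open>(X, S)\<close> to a subset of \<^typ>\<open>'a\<close>.\<close>

definition max_equicontinuous_factor ::
  "'a topology \<Rightarrow> ('a \<Rightarrow> 'a) \<Rightarrow> 'b topology \<Rightarrow> ('b \<Rightarrow> 'b) \<Rightarrow> ('a \<Rightarrow> 'b) \<Rightarrow> bool" where
  "max_equicontinuous_factor X S Y R \<pi> \<longleftrightarrow>
     equicontinuous_system Y R \<and> factor_map X S Y R \<pi> \<and>
     (\<forall>(Z :: 'a topology) Q \<rho>.
        equicontinuous_system Z Q \<and> factor_map X S Z Q \<rho> \<longrightarrow>
        (\<exists>\<psi>. factor_map Y R Z Q \<psi> \<and> (\<forall>x\<in>topspace X. \<rho> x = \<psi> (\<pi> x))))"

definition automorphism :: "'a topology \<Rightarrow> ('a \<Rightarrow> 'a) \<Rightarrow> ('a \<Rightarrow> 'a) \<Rightarrow> bool" where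
  "automorphism X S F \<longleftrightarrow>
     homeomorphic_map X X F \<and> (\<forall>x\<in>topspace X. F (S x) = S (F x))"


section \<open>Two-sided binary sequences\<close>

text \<open>The alphabet \<open>{0,1}\<close> is \<^typ>\<open>bool\<close>, with \<^term>\<open>True\<close> for 1. The type class topology on
  \<^typ>\<open>int \<Rightarrow> bool\<close> is the product of the discrete topologies.\<close>

definition shift_by :: "int \<Rightarrow> (int \<Rightarrow> bool) \<Rightarrow> (int \<Rightarrow> bool)" where
  "shift_by k x = (\<lambda>i. x (i + k))"

abbreviation shift :: "(int \<Rightarrow> bool) \<Rightarrow> (int \<Rightarrow> bool)" where
  "shift \<equiv> shift_by 1"

definition orbit_closure :: "(int \<Rightarrow> bool) \<Rightarrow> (int \<Rightarrow> bool) topology" where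
  "orbit_closure \<eta> = top_of_set (closure (range (\<lambda>k. shift_by k \<eta>)))"

definition trivial_centralizer :: "(int \<Rightarrow> bool) \<Rightarrow> bool" where
  "trivial_centralizer \<eta> \<longleftrightarrow>
     (\<forall>F. automorphism (orbit_closure \<eta>) shift F \<longrightarrow>
          (\<exists>k. \<forall>x\<in>topspace (orbit_closure \<eta>). F x = shift_by k x))"

text \<open>A word indexed by \<open>[-m:m]\<close> is an extensional function on that interval.\<close>

definition described_by_code ::
  "(int \<Rightarrow> bool) \<Rightarrow> ((int \<Rightarrow> bool) \<Rightarrow> (int \<Rightarrow> bool)) \<Rightarrow> nat \<Rightarrow> ((int \<Rightarrow> bool) \<Rightarrow> bool) \<Rightarrow> bool" where
  "described_by_code \<eta> F m c \<longleftrightarrow>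
     (\<forall>x\<in>topspace (orbit_closure \<eta>). \<forall>s.
        F x s = c (restrict (\<lambda>j. x (s + j)) {- int m..int m}))"


section \<open>Toeplitz sequences and their holes\<close>

text \<open>Sequences indexed by the positive integers, such as \<open>(p_n)\<close>, are functions on \<^typ>\<open>nat\<close>
  whose value at 0 is never used.\<close>

definition toeplitz :: "(int \<Rightarrow> bool) \<Rightarrow> (nat \<Rightarrow> nat) \<Rightarrow> bool" where
  "toeplitz \<eta> p \<longleftrightarrow>
     (\<forall>n\<ge>1. p n dvd p (Suc n)) \<and> filterlim p at_top sequentially \<and>
     \<not> (\<exists>q>0. \<forall>k. \<eta> (k + q) = \<eta> k) \<and>
     (\<forall>k. \<exists>n\<ge>1. \<forall>j. \<eta> (k + j * int (p n)) = \<eta> k)"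

definition constant_places :: "(int \<Rightarrow> bool) \<Rightarrow> (nat \<Rightarrow> nat) \<Rightarrow> bool \<Rightarrow> nat \<Rightarrow> int set" where
  "constant_places \<eta> p i n = {k. \<forall>j. \<eta> (k + j * int (p n)) = i}"

definition holes :: "(int \<Rightarrow> bool) \<Rightarrow> (nat \<Rightarrow> nat) \<Rightarrow> nat \<Rightarrow> int set" where
  "holes \<eta> p n = UNIV - (constant_places \<eta> p False n \<union> constant_places \<eta> p True n)"

definition essential_holes :: "(int \<Rightarrow> bool) \<Rightarrow> (nat \<Rightarrow> nat) \<Rightarrow> nat \<Rightarrow> int set" where
  "essential_holes \<eta> p N =
     {k \<in> holes \<eta> p N. \<forall>n\<ge>N. holes \<eta> p n \<inter> range (\<lambda>j. k + j * int (p N)) \<noteq> {}}"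

definition minimal_period :: "int set \<Rightarrow> nat" where
  "minimal_period H = (LEAST t. t > 0 \<and> (\<forall>k. k + int t \<in> H \<longleftrightarrow> k \<in> H))"


section \<open>The odometer\<close>

text \<open>The ring of integers modulo \<open>p n\<close> is represented by the residues \<open>0, \<dots>, p n - 1\<close>. The
  inverse limit inherits the product topology, which is the type class topology of
  \<^typ>\<open>nat \<Rightarrow> int\<close>; the coordinate 0, outside the index set, is frozen.\<close>

definition odo :: "(nat \<Rightarrow> nat) \<Rightarrow> (nat \<Rightarrow> int) set" where
  "odo p = {g \<in> (\<Pi>\<^sub>E n\<in>{1..}. {0..<int (p n)}). \<forall>n\<ge>1. g (Suc n) mod int (p n) = g n}"

definition odo_Delta :: "(nat \<Rightarrow> nat) \<Rightarrow> int \<Rightarrow> (nat \<Rightarrow> int)" where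
  "odo_Delta p k = restrict (\<lambda>n. k mod int (p n)) {1..}"

definition odo_add :: "(nat \<Rightarrow> nat) \<Rightarrow> (nat \<Rightarrow> int) \<Rightarrow> (nat \<Rightarrow> int) \<Rightarrow> (nat \<Rightarrow> int)" where
  "odo_add p g h = restrict (\<lambda>n. (g n + h n) mod int (p n)) {1..}"

definition odo_diff :: "(nat \<Rightarrow> nat) \<Rightarrow> (nat \<Rightarrow> int) \<Rightarrow> (nat \<Rightarrow> int) \<Rightarrow> (nat \<Rightarrow> int)" where
  "odo_diff p g h = restrict (\<lambda>n. (g n - h n) mod int (p n)) {1..}"

definition odo_T :: "(nat \<Rightarrow> nat) \<Rightarrow> (nat \<Rightarrow> int) \<Rightarrow> (nat \<Rightarrow> int)" where
  "odo_T p g = odo_add p g (odo_Delta p 1)"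

definition cylinder :: "(nat \<Rightarrow> nat) \<Rightarrow> nat \<Rightarrow> (nat \<Rightarrow> int) \<Rightarrow> (nat \<Rightarrow> int) set" where
  "cylinder p n h = {g \<in> odo p. g n = h n}"

definition V_set :: "(int \<Rightarrow> bool) \<Rightarrow> (nat \<Rightarrow> nat) \<Rightarrow> bool \<Rightarrow> (nat \<Rightarrow> int) set" where
  "V_set \<eta> p i =
     (\<Union>n\<in>{1..}. \<Union>k\<in>constant_places \<eta> p i n \<inter> {0..<int (p n)}. cylinder p n (odo_Delta p k))"

definition window :: "(int \<Rightarrow> bool) \<Rightarrow> (nat \<Rightarrow> nat) \<Rightarrow> (nat \<Rightarrow> int) set" where
  "window \<eta> p = top_of_set (odo p) closure_of V_set \<eta> p True"

definition window_boundary :: "(int \<Rightarrow> bool) \<Rightarrow> (nat \<Rightarrow> nat) \<Rightarrow> (nat \<Rightarrow> int) set" where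
  "window_boundary \<eta> p = top_of_set (odo p) frontier_of window \<eta> p"

lemma toeplitz_dvd:
  assumes "toeplitz \<eta> p" "1 \<le> n" "n \<le> n'"
  shows "p n dvd p n'"
  using assms(3)
proof (induction n' rule: dec_induct)
  case (step k)
  then have "p k dvd p (Suc k)" using assms by (simp add: toeplitz_def)
  then show ?case using step dvd_trans by blast
qed simp

lemma toeplitz_pos:
  assumes "toeplitz \<eta> p" "1 \<le> n"
  shows "p n > 0"
proof -
  have "eventually (\<lambda>k. 1 \<le> p k) sequentially"
    using assms(1) unfolding toeplitz_def filterlim_at_top by blast
  then obtain k where k: "\<And>j. j \<ge> k \<Longrightarrow> 1 \<le> p j"
    unfolding eventually_sequentially by blast
  have "p n dvd p (max n k)" using toeplitz_dvd[OF assms(1,2)] by simp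
  moreover have "p (max n k) \<ge> 1" using k by simp
  ultimately show ?thesis using dvd_pos_nat by fastforce
qed

lemma odo_mod:
  assumes "toeplitz \<eta> p" "g \<in> odo p" "1 \<le> n" "n \<le> n'"
  shows "g n' mod int (p n) = g n"
  using assms(4)
proof (induction n' rule: dec_induct)
  case base
  have "g n \<in> {0..<int (p n)}" using assms(2,3) by (auto simp: odo_def dest: PiE_mem)
  then show ?case by simp
next
  case (step k)
  have "g k = g (Suc k) mod int (p k)" using assms(2,3) step by (simp add: odo_def)
  moreover have "int (p n) dvd int (p k)" using toeplitz_dvd[OF assms(1,3)] step by simp
  ultimately show ?case using step by (metis mod_mod_cancel)
qed

lemma odo_Delta_in_odo:
  assumes "toeplitz \<eta> p" shows "odo_Delta p k \<in> odo p"
proof -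
  have "int (p n) dvd int (p (Suc n))" if "n \<ge> 1" for n
    using toeplitz_dvd[OF assms, of n "Suc n"] that by simp
  then show ?thesis using toeplitz_pos[OF assms]
    by (auto simp: odo_def odo_Delta_def mod_mod_cancel)
qed

lemma V_set_iff:
  assumes "toeplitz \<eta> p" "g \<in> odo p"
  shows "g \<in> V_set \<eta> p i \<longleftrightarrow> (\<exists>n\<ge>1. g n \<in> constant_places \<eta> p i n)"
proof
  assume "g \<in> V_set \<eta> p i"
  then show "\<exists>n\<ge>1. g n \<in> constant_places \<eta> p i n"
    by (auto simp: V_set_def cylinder_def odo_Delta_def)
next
  assume "\<exists>n\<ge>1. g n \<in> constant_places \<eta> p i n"
  then obtain n where n: "n \<ge> 1" "g n \<in> constant_places \<eta> p i n" by blast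
  have "g n \<in> {0..<int (p n)}" using assms(2) n by (auto simp: odo_def dest: PiE_mem)
  then show "g \<in> V_set \<eta> p i" using n assms(2)
    by (auto simp: V_set_def cylinder_def odo_Delta_def intro!: bexI[of _ n] bexI[of _ "g n"])
qed

lemma constant_places_mono:
  assumes "toeplitz \<eta> p" "g \<in> odo p" "1 \<le> n" "n \<le> n'" "g n \<in> constant_places \<eta> p i n"
  shows "g n' \<in> constant_places \<eta> p i n'"
proof -
  obtain d where d: "p n' = p n * d" using toeplitz_dvd[OF assms(1,3,4)] by (elim dvdE)
  have "g n' = g n + (g n' div int (p n)) * int (p n)"
    using odo_mod[OF assms(1-4)] by (metis add.commute div_mult_mod_eq)
  then have eq: "g n' + j * int (p n') =
      g n + (g n' div int (p n) + j * int d) * int (p n)" for j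
    by (simp add: d algebra_simps)
  have "\<eta> (g n' + j * int (p n')) = i" for j
    unfolding eq using assms(5) by (simp add: constant_places_def)
  then show ?thesis by (simp add: constant_places_def)
qed

lemma V_set_disjoint:
  assumes "toeplitz \<eta> p"
  shows "V_set \<eta> p i \<inter> V_set \<eta> p (\<not> i) = {}"
proof (rule ccontr)
  assume "\<not> ?thesis"
  then obtain g where g: "g \<in> V_set \<eta> p i" "g \<in> V_set \<eta> p (\<not> i)" by blast
  then have odo: "g \<in> odo p" by (auto simp: V_set_def cylinder_def)
  obtain n n' where n: "n \<ge> 1" "n' \<ge> 1" "g n \<in> constant_places \<eta> p i n"
      "g n' \<in> constant_places \<eta> p (\<not> i) n'"
    using g V_set_iff[OF assms odo] by blast
  have "g (max n n') \<in> constant_places \<eta> p i (max n n')"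
       "g (max n n') \<in> constant_places \<eta> p (\<not> i) (max n n')"
    using constant_places_mono[OF assms odo] n by auto
  then show False by (auto simp: constant_places_def)
qed

lemma openin_V_set: "openin (top_of_set (odo p)) (V_set \<eta> p i)"
proof -
  have "openin (top_of_set (odo p)) (cylinder p n h)" for n h
  proof -
    have "open ((\<lambda>g :: nat \<Rightarrow> int. g n) -` {h n})"
      by (intro open_vimage continuous_on_product_coordinates) (auto simp: open_discrete)
    moreover have "cylinder p n h = odo p \<inter> (\<lambda>g. g n) -` {h n}" by (auto simp: cylinder_def)
    ultimately show ?thesis by (auto simp: openin_open)
  qed
  then show ?thesis unfolding V_set_def by (intro openin_Union) auto
qed

lemma open_contains_cylinder:
  assumes "toeplitz \<eta> p" "open T" "g \<in> T" "g \<in> odo p"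
  shows "\<exists>N\<ge>1. cylinder p N g \<subseteq> T"
proof -
  obtain X where X: "g \<in> Pi\<^sub>E UNIV X" "\<And>i. open (X i)" "finite {i. X i \<noteq> UNIV}"
      "Pi\<^sub>E UNIV X \<subseteq> T"
    using product_topology_open_contains_basis[OF assms(2)[unfolded open_fun_def] assms(3)] by auto
  define N where "N = Max (insert 1 {i. X i \<noteq> UNIV})"
  have N: "N \<ge> 1" "\<And>i. X i \<noteq> UNIV \<Longrightarrow> i \<le> N"
    using X(3) by (auto simp: N_def)
  have "h \<in> T" if h: "h \<in> cylinder p N g" for h
  proof -
    have ho: "h \<in> odo p" "h N = g N" using h by (auto simp: cylinder_def)
    have "h i \<in> X i" for i
    proof (cases "X i = UNIV")
      case False
      have "h i = g i"
      proof (cases "i \<ge> 1")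
        case True
        then show ?thesis
          using odo_mod[OF assms(1) ho(1) True N(2)[OF False]]
            odo_mod[OF assms(1,4) True N(2)[OF False]] ho(2) by simp
      next
        case False
        then have "h i = undefined" "g i = undefined"
          using ho(1) assms(4) by (auto simp: odo_def PiE_def extensional_def)
        then show ?thesis by simp
      qed
      then show ?thesis using X(1) by (auto simp: PiE_def Pi_def)
    qed simp
    then show ?thesis using X(4) by (auto simp: PiE_def)
  qed
  then show ?thesis using N(1) by blast
qed

lemma closure_V_set:
  assumes "toeplitz \<eta> p"
  shows "top_of_set (odo p) closure_of V_set \<eta> p i = odo p - V_set \<eta> p (\<not> i)"
proof
  show "top_of_set (odo p) closure_of V_set \<eta> p i \<subseteq> odo p - V_set \<eta> p (\<not> i)"
  proof (rule closure_of_minimal)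
    show "V_set \<eta> p i \<subseteq> odo p - V_set \<eta> p (\<not> i)"
      using V_set_disjoint[OF assms, of i] by (auto simp: V_set_def cylinder_def)
    show "closedin (top_of_set (odo p)) (odo p - V_set \<eta> p (\<not> i))"
      using openin_V_set[of p \<eta> "\<not> i"] by (metis closedin_diff closedin_topspace topspace_euclidean_subtopology)
  qed
  show "odo p - V_set \<eta> p (\<not> i) \<subseteq> top_of_set (odo p) closure_of V_set \<eta> p i"
  proof
    fix g assume g: "g \<in> odo p - V_set \<eta> p (\<not> i)"
    have "\<exists>h. h \<in> V_set \<eta> p i \<and> h \<in> U" if U: "g \<in> U" "openin (top_of_set (odo p)) U" for U
    proof -
      obtain T where T: "open T" "U = odo p \<inter> T" using U(2) by (auto simp: openin_open)
      obtain N where N: "N \<ge> 1" "cylinder p N g \<subseteq> T"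
        using open_contains_cylinder[OF assms T(1)] U(1) T(2) g by blast
      have "g N \<notin> constant_places \<eta> p (\<not> i) N"
        using g V_set_iff[OF assms] N(1) by auto
      then obtain j where j: "\<eta> (g N + j * int (p N)) = i"
        by (auto simp: constant_places_def)
      define k where "k = g N + j * int (p N)"
      have "g N \<in> {0..<int (p N)}" using g N(1) by (auto simp: odo_def dest: PiE_mem)
      then have "odo_Delta p k N = g N" using N(1) by (simp add: odo_Delta_def k_def)
      then have "odo_Delta p k \<in> U"
        using N(2) T(2) odo_Delta_in_odo[OF assms] by (auto simp: cylinder_def)
      moreover obtain n where n: "n \<ge> 1" "\<And>l. \<eta> (k + l * int (p n)) = \<eta> k"
        using assms unfolding toeplitz_def by blast
      have "odo_Delta p k n \<in> constant_places \<eta> p i n"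
      proof -
        have "k mod int (p n) + l * int (p n) = k + (l - k div int (p n)) * int (p n)" for l
          by (simp add: minus_div_mult_eq_mod[symmetric] algebra_simps)
        then show ?thesis using n j
          by (simp add: constant_places_def odo_Delta_def k_def[symmetric])
      qed
      then have "odo_Delta p k \<in> V_set \<eta> p i"
        using V_set_iff[OF assms odo_Delta_in_odo[OF assms]] n(1) by blast
      ultimately show ?thesis by blast
    qed
    then show "g \<in> top_of_set (odo p) closure_of V_set \<eta> p i"
      using g by (auto simp: in_closure_of)
  qed
qed

lemma window_eq:
  assumes "toeplitz \<eta> p"
  shows "window \<eta> p = odo p - V_set \<eta> p False"
  using closure_V_set[OF assms, of True] by (simp add: window_def)

lemma window_boundary_eq:
  assumes "toeplitz \<eta> p"
  shows "window_boundary \<eta> p = odo p - (V_set \<eta> p False \<union> V_set \<eta> p True)"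
proof -
  have c: "closedin (top_of_set (odo p)) (window \<eta> p)"
    by (simp add: window_def)
  have i: "top_of_set (odo p) interior_of (odo p - V_set \<eta> p False) =
        odo p - top_of_set (odo p) closure_of V_set \<eta> p False"
    using interior_of_complement[of "top_of_set (odo p)" "V_set \<eta> p False"] by simp
  show ?thesis
    unfolding window_boundary_def frontier_of_def closure_of_closedin[OF c]
    unfolding window_eq[OF assms] i closure_V_set[OF assms, of False]
    by auto
qed

definition odo_dvd :: "nat \<Rightarrow> nat \<Rightarrow> int \<Rightarrow> bool" where
  "odo_dvd N t z \<longleftrightarrow> (\<exists>w. [z = int t * w] (mod int N))"


section \<open>The set of integers attached to an automorphism\<close>

definition y_of ::
  "(int \<Rightarrow> bool) \<Rightarrow> (nat \<Rightarrow> nat) \<Rightarrow> ((int \<Rightarrow> bool) \<Rightarrow> (nat \<Rightarrow> int)) \<Rightarrow>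
   ((int \<Rightarrow> bool) \<Rightarrow> (int \<Rightarrow> bool)) \<Rightarrow> (nat \<Rightarrow> int)" where
  "y_of \<eta> p \<pi> F =
     (THE y. y \<in> odo p \<and> (\<forall>x\<in>topspace (orbit_closure \<eta>). \<pi> (F x) = odo_add p (\<pi> x) y))"

definition Vk_set :: "(int \<Rightarrow> bool) \<Rightarrow> (nat \<Rightarrow> nat) \<Rightarrow> (nat \<Rightarrow> int) \<Rightarrow> int \<Rightarrow> (nat \<Rightarrow> int) set" where
  "Vk_set \<eta> p y k =
     window_boundary \<eta> p \<inter>
     (\<lambda>g. odo_diff p (odo_add p g (odo_Delta p k)) y) ` window_boundary \<eta> p"

definition K_set ::
  "(int \<Rightarrow> bool) \<Rightarrow> (nat \<Rightarrow> nat) \<Rightarrow> ((int \<Rightarrow> bool) \<Rightarrow> (nat \<Rightarrow> int)) \<Rightarrow>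
   ((int \<Rightarrow> bool) \<Rightarrow> (int \<Rightarrow> bool)) \<Rightarrow> int set" where
  "K_set \<eta> p \<pi> F =
     {k. top_of_set (window_boundary \<eta> p) interior_of Vk_set \<eta> p (y_of \<eta> p \<pi> F) k \<noteq> {}}"

definition kappa ::
  "(int \<Rightarrow> bool) \<Rightarrow> (nat \<Rightarrow> nat) \<Rightarrow> ((int \<Rightarrow> bool) \<Rightarrow> (nat \<Rightarrow> int)) \<Rightarrow>
   ((int \<Rightarrow> bool) \<Rightarrow> (int \<Rightarrow> bool)) \<Rightarrow> nat \<Rightarrow> nat \<Rightarrow> int" where
  "kappa \<eta> p \<pi> F n a =
     (THE k. k \<in> K_set \<eta> p \<pi> F \<and> odo_dvd (p n) a (y_of \<eta> p \<pi> F n - k))"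


section \<open>Sets of multiples\<close>

definition multiples :: "nat set \<Rightarrow> int set" where
  "multiples A = {z. \<exists>a\<in>A. int a dvd z}"

definition primitive :: "nat set \<Rightarrow> bool" where
  "primitive A \<longleftrightarrow> (\<forall>a\<in>A. \<forall>b\<in>A. a dvd b \<longrightarrow> a = b)"

definition gcd_edges :: "nat set \<Rightarrow> nat \<Rightarrow> (nat \<times> nat) set" where
  "gcd_edges A m = {(a, a'). a \<in> A \<and> a' \<in> A \<and> gcd a a' > 2 * m}"

end

(* The holes of all levels are the projections of the boundary B of the window. At each level the
essential holes H form a p_n-periodic union of sets a Z minus multiples of S(a); such a set is
invariant under multiplication by units modulo p_n, and so every a in A_n divides p_n.

Suppose that a translation by z maps a nonempty open piece of B, say the points agreeing with g at
level N, into B. At a high level n choose a in A_n dividing g_n. Units r modulo p_n in a fixed class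
modulo a divisor of p_N yield holes h = a beta r in the piece, and h + z_n must be divisible by some
a' in A_n. Among these units the proportion with a' dividing h + z_n is at most a constant (depending
on N only) times 1 / phi(a' / gcd(a', a)). As these bounds add up to less than 1 over all a' other
than a, some unit forces a to divide h + z_n, hence z_n.

Fibres of the factor map over B are exactly those that contain points with different symbols at 0.
Injectivity of F thus shows that the sets V_k cover B, so by Baire some V_k has interior inside every
open piece of B, which gives (b) and (d). A block code for F yields the converse
inclusion with finitely many shifts. Both inclusions together would, for k in K beyond the radius m of
the code, translate a piece of B into B by a nonzero integer, which is then divisible by elements of
A_n for all n, whereas min A_n tends to infinity. So K is contained in [-m, m]. *)
theory Submission
  imports Defs "HOL-Number_Theory.Residues"
begin

section \<open>Units in residue classes\<close>

lemma coprime_residue_lift: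
  fixes b q M :: nat
  assumes "coprime b q" "q dvd M" "M > 0"
  obtains r where "coprime r M" "[r = b] (mod q)"
proof
  define t where "t = \<Prod>{l \<in> prime_factors M. \<not> l dvd b}"
  have t: "l dvd t \<longleftrightarrow> \<not> l dvd b" if l: "prime l" "l dvd M" for l
  proof
    assume "l dvd t"
    then obtain l' where "l' \<in> prime_factors M" "\<not> l' dvd b" "l dvd l'"
      using l(1) unfolding t_def by (subst (asm) prime_dvd_prod_iff) auto
    then show "\<not> l dvd b"
      using l(1) by (metis in_prime_factors_iff primes_dvd_imp_eq)
  next
    assume "\<not> l dvd b"
    then have "l \<in> {l \<in> prime_factors M. \<not> l dvd b}"
      using l assms(3) by (simp add: in_prime_factors_iff)
    then show "l dvd t"
      unfolding t_def by (intro dvd_prodI) auto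
  qed
  show "coprime (b + q * t) M"
  proof (rule ccontr)
    assume "\<not> coprime (b + q * t) M"
    then obtain l where l: "prime l" "l dvd b + q * t" "l dvd M"
      by (metis coprime_iff_gcd_eq_1 gcd_greatest_iff prime_factor_nat)
    show False
    proof (cases "l dvd b")
      case True
      then have "l dvd q * t"
        using l(2) dvd_add_right_iff by blast
      moreover have "\<not> l dvd q"
        using True assms(1) l(1) by (meson coprime_common_divisor not_prime_unit)
      ultimately show False
        using t[OF l(1,3)] True l(1) prime_dvd_mult_iff by blast
    next
      case False
      then have "l dvd q * t"
        using t[OF l(1,3)] by simp
      then show False
        using l(2) False dvd_add_left_iff by blast
    qed
  qed
  show "[b + q * t = b] (mod q)"
    by (simp add: cong_def)
qed

lemma card_coprime_below: "card {r. r < M \<and> coprime r M} = totient M"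
proof (cases "M \<le> 1")
  case True
  then consider "M = 0" | "M = 1" by linarith
  then show ?thesis by cases auto
next
  case False
  then have "{r. r < M \<and> coprime r M} = totatives M"
    by (auto simp: in_totatives_iff le_less intro!: Nat.gr0I)
  then show ?thesis by (simp add: totient_def)
qed

lemma card_coprime_residue_le:
  fixes u v q M :: nat
  assumes "q dvd M" "M > 0" "coprime u q" "coprime v q"
  shows "card {r. r < M \<and> coprime r M \<and> [r = u] (mod q)}
       \<le> card {r. r < M \<and> coprime r M \<and> [r = v] (mod q)}"
proof -
  obtain u' where u': "[u * u' = 1] (mod q)"
    using assms(3) by (metis cong_solve_coprime_nat One_nat_def)
  then have "coprime u' q"
    by (metis assms(3) coprime_iff_invertible_nat mult.commute One_nat_def)
  then obtain w where w: "coprime w M" "[w = v * u'] (mod q)"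
    using coprime_residue_lift[of "v * u'" q M] assms by auto
  show ?thesis
  proof (rule card_inj_on_le[where f = "\<lambda>r. w * r mod M"])
    show "inj_on (\<lambda>r. w * r mod M) {r. r < M \<and> coprime r M \<and> [r = u] (mod q)}"
    proof (rule inj_onI)
      fix r s assume "r \<in> {r. r < M \<and> coprime r M \<and> [r = u] (mod q)}"
        "s \<in> {r. r < M \<and> coprime r M \<and> [r = u] (mod q)}" "w * r mod M = w * s mod M"
      then show "r = s"
        using w(1) by (metis (mono_tags, lifting) cong_def cong_mult_lcancel_nat mem_Collect_eq mod_less)
    qed
    have "[w * r = v] (mod q)" if "[r = u] (mod q)" for r
    proof -
      have "[w * r = v * u' * u] (mod q)"
        using w(2) that by (rule cong_mult)
      also have "v * u' * u = v * (u * u')" by simp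
      also have "[v * (u * u') = v * 1] (mod q)"
        using u' by (intro cong_mult cong_refl)
      finally show ?thesis by simp
    qed
    moreover have "[w * r mod M = w * r] (mod q)" for r
      using assms(1) by (simp add: cong_def mod_mod_cancel)
    ultimately show "(\<lambda>r. w * r mod M) ` {r. r < M \<and> coprime r M \<and> [r = u] (mod q)}
        \<subseteq> {r. r < M \<and> coprime r M \<and> [r = v] (mod q)}"
      using w(1) assms(2) by (auto intro: cong_trans)
  qed simp
qed

lemma card_coprime_residue:
  fixes u q M :: nat
  assumes "q dvd M" "M > 0" "coprime u q"
  shows "card {r. r < M \<and> coprime r M \<and> [r = u] (mod q)} * totient q = totient M"
proof -
  let ?U = "\<lambda>v. {r. r < M \<and> coprime r M \<and> [r = v] (mod q)}"
  have q: "q > 0" using assms dvd_pos_nat by blast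
  have "{r. r < M \<and> coprime r M} = (\<Union>v\<in>{v. v < q \<and> coprime v q}. ?U v)"
  proof (intro equalityI subsetI)
    fix r assume r: "r \<in> {r. r < M \<and> coprime r M}"
    then have "coprime (r mod q) q"
      using assms(1) by (metis coprime_mod_left_iff coprime_divisors dvd_refl mem_Collect_eq q less_irrefl)
    then show "r \<in> (\<Union>v\<in>{v. v < q \<and> coprime v q}. ?U v)"
      using r q by (auto simp: cong_def intro!: exI[of _ "r mod q"])
  qed auto
  then have "totient M = card (\<Union>v\<in>{v. v < q \<and> coprime v q}. ?U v)"
    using card_coprime_below by metis
  also have "\<dots> = (\<Sum>v\<in>{v. v < q \<and> coprime v q}. card (?U v))"
    by (subst card_UN_disjoint) (auto simp: cong_def)
  also have "\<dots> = (\<Sum>v\<in>{v. v < q \<and> coprime v q}. card (?U u))"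
    using card_coprime_residue_le[OF assms(1,2)] assms(3)
    by (intro sum.cong) (auto intro: le_antisym)
  also have "\<dots> = card (?U u) * totient q"
    by (simp add: card_coprime_below)
  finally show ?thesis by simp
qed

lemma coprime_avoiding_residues:
  fixes M Q c :: nat and q v :: "'i \<Rightarrow> nat"
  assumes "M > 0" "Q dvd M" "coprime c Q" "finite I" "\<And>i. i \<in> I \<Longrightarrow> q i dvd M"
    and small: "(\<Sum>i\<in>I. real (totient Q) / real (totient (q i))) < 1"
  obtains r where "coprime r M" "[r = c] (mod Q)" "\<And>i. i \<in> I \<Longrightarrow> \<not> [r = v i] (mod q i)"
proof -
  let ?U = "\<lambda>u k. {r. r < M \<and> coprime r M \<and> [r = u] (mod k)}"
  have Q: "totient Q > 0" using assms(1,2) dvd_pos_nat by auto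
  have M: "real (totient M) > 0" using assms(1) by simp
  have le: "real (card (?U (v i) (q i))) \<le> real (totient M) / real (totient (q i))" if i: "i \<in> I" for i
  proof (cases "coprime (v i) (q i)")
    case True
    have "totient (q i) > 0" using assms(1) assms(5)[OF i] dvd_pos_nat by auto
    then show ?thesis
      using card_coprime_residue[OF assms(5)[OF i] assms(1) True]
      by (metis (no_types, lifting) nonzero_eq_divide_eq of_nat_0_eq_iff of_nat_mult order_refl less_not_refl2)
  next
    case False
    have "coprime (v i) (q i)" if "coprime r M" "[r = v i] (mod q i)" for r
      using that assms(5)[OF i] by (metis cong_imp_coprime coprime_divisors dvd_refl)
    then have "?U (v i) (q i) = {}" using False by blast
    then show ?thesis by (metis card.empty of_nat_0 of_nat_0_le_iff divide_nonneg_nonneg)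
  qed
  have "real (card (\<Union>i\<in>I. ?U (v i) (q i))) \<le> (\<Sum>i\<in>I. real (card (?U (v i) (q i))))"
    unfolding of_nat_sum[symmetric] of_nat_le_iff by (rule card_UN_le[OF assms(4)])
  also have "\<dots> \<le> (\<Sum>i\<in>I. real (totient M) / real (totient (q i)))"
    by (intro sum_mono le)
  also have "\<dots> = real (totient M) / real (totient Q) * (\<Sum>i\<in>I. real (totient Q) / real (totient (q i)))"
    using Q by (simp add: sum_distrib_left)
  also have "\<dots> < real (totient M) / real (totient Q) * 1"
    using small M Q by (intro mult_strict_left_mono) auto
  also have "\<dots> = real (card (?U c Q))"
    using Q by (simp add: card_coprime_residue[OF assms(2,1,3), symmetric])
  finally have "card (\<Union>i\<in>I. ?U (v i) (q i)) < card (?U c Q)" by simp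
  then have "\<not> ?U c Q \<subseteq> (\<Union>i\<in>I. ?U (v i) (q i))"
    using assms(4) card_mono[of "\<Union>i\<in>I. ?U (v i) (q i)" "?U c Q"] by (auto simp: not_less[symmetric])
  then show ?thesis using that by blast
qed

lemma totient_mult_le: "totient (x * y) \<le> x * totient y"
proof -
  let ?U = "\<lambda>n. {r. r < n \<and> coprime r n}"
  have "?U (x * y) \<subseteq> (\<lambda>(j, s). j * y + s) ` ({..<x} \<times> ?U y)"
  proof
    fix r assume r: "r \<in> ?U (x * y)"
    then have "y > 0" by (auto intro!: Nat.gr0I)
    then have "coprime (r mod y) y" "r div y < x" "r mod y < y"
      using r by (auto simp: less_mult_imp_div_less coprime_commute)
    then show "r \<in> (\<lambda>(j, s). j * y + s) ` ({..<x} \<times> ?U y)"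
      by (intro image_eqI[of _ _ "(r div y, r mod y)"]) auto
  qed
  then have "card (?U (x * y)) \<le> card ({..<x} \<times> ?U y)"
    by (rule surj_card_le[rotated]) simp
  then show ?thesis by (simp only: card_coprime_below card_cartesian_product card_lessThan)
qed

lemma cong_cancel_div_gcd:
  fixes x r v k :: nat
  assumes "[x * r = x * v] (mod k)" "k > 0"
  shows "[r = v] (mod (k div gcd k x))"
proof -
  define g where "g = gcd k x"
  have g: "g > 0" using assms(2) by (simp add: g_def)
  have k: "k = g * (k div g)" and x: "x = g * (x div g)" by (simp_all add: g_def)
  have "[g * ((x div g) * r) = g * ((x div g) * v)] (mod g * (k div g))"
    using assms(1) k x by (metis mult.assoc)
  then have "[(x div g) * r = (x div g) * v] (mod (k div g))"
    using g by (simp add: cong_def mod_mult_mult1)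
  moreover have "coprime (x div g) (k div g)"
    unfolding g_def using assms(2) by (metis div_gcd_coprime coprime_commute less_irrefl)
  ultimately show ?thesis
    unfolding g_def by (simp add: cong_mult_lcancel_nat)
qed

lemma totient_div_gcd_le:
  fixes k a b :: nat
  assumes "k > 0" "b > 0"
  shows "totient (k div gcd k a) \<le> b * totient (k div gcd k (a * b))"
proof -
  obtain e where e: "gcd k (a * b) = gcd k a * e"
    by (metis dvdE dvd_mult2 gcd_dvd1 gcd_dvd2 gcd_greatest)
  have "gcd k (a * b) dvd gcd k a * b"
    by (metis dvd_mult2 gcd_dvd1 gcd_dvd2 gcd_greatest gcd_mult_distrib_nat mult.commute)
  moreover have g: "gcd k a > 0" using assms by simp
  ultimately have "e \<le> b"
    using e assms(2) by (auto intro: dvd_imp_le)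
  obtain f where f: "k = gcd k (a * b) * f" by (meson dvdE gcd_dvd1)
  then have "k = gcd k a * (e * f)" using e by (simp add: mult.assoc)
  then have "k div gcd k a = e * f" using g by (metis nonzero_mult_div_cancel_left less_irrefl)
  moreover have "k div gcd k (a * b) = f"
    using f assms by (metis nonzero_mult_div_cancel_left gcd_eq_0_iff less_irrefl)
  ultimately show ?thesis
    using totient_mult_le[of e f] \<open>e \<le> b\<close> by (metis le_trans mult_le_mono1)
qed

section \<open>Periodic sets of restricted multiples\<close>

locale periodic_multiples =
  fixes H :: "int set" and A :: "nat set" and S :: "nat \<Rightarrow> nat set" and P :: nat
  assumes P_pos: "P > 0"
    and periodic: "k + int P \<in> H \<longleftrightarrow> k \<in> H"
    and A_pos: "A \<subseteq> {0<..}"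
    and A_primitive: "primitive A"
    and H_eq: "H = (\<Union>a\<in>A. {z. int a dvd z} - multiples (S a))"
    and nonempty: "a \<in> A \<Longrightarrow> {z. int a dvd z} - multiples (S a) \<noteq> {}"
begin

lemma periodic_mult: "k + j * int P \<in> H \<longleftrightarrow> k \<in> H"
proof (induction j rule: int_induct[where k = 0])
  case (step1 i)
  then show ?case using periodic[of "k + i * int P"] by (simp add: algebra_simps)
next
  case (step2 i)
  then show ?case using periodic[of "k + (i - 1) * int P"] by (simp add: algebra_simps)
qed simp

lemma cong_mem: "[x = y] (mod int P) \<Longrightarrow> x \<in> H \<Longrightarrow> y \<in> H"
  unfolding cong_iff_lin using periodic_mult by (metis mult.commute)

lemma cong_mem_nat: "[x = y] (mod P) \<Longrightarrow> int x \<in> H \<Longrightarrow> int y \<in> H"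
  by (rule cong_mem[of "int x"]) (simp_all add: cong_int_iff)

lemma interval_below:
  assumes "h \<in> H"
  obtains a where "a \<in> A" "int a dvd h" "\<And>x. int a dvd x \<Longrightarrow> x dvd h \<Longrightarrow> x \<in> H"
proof -
  obtain a where a: "a \<in> A" "int a dvd h" "h \<notin> multiples (S a)"
    using assms H_eq by auto
  have "x \<in> H" if "int a dvd x" "x dvd h" for x
  proof -
    have "x \<notin> multiples (S a)"
      using a(3) that(2) by (auto simp: multiples_def dest: dvd_trans)
    then show ?thesis using a(1) that(1) H_eq by auto
  qed
  then show ?thesis using that a by blast
qed

lemma A_subset:
  assumes "a \<in> A"
  shows "int a \<in> H"
proof -
  obtain x where "int a dvd x" "x \<notin> multiples (S a)"
    using nonempty[OF assms] by auto
  then have "int a \<notin> multiples (S a)"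
    unfolding multiples_def mem_Collect_eq by (meson dvd_trans)
  then show ?thesis using assms by (subst H_eq) (blast intro: dvd_refl)
qed

lemma minimal:
  assumes "a \<in> A" "int x \<in> H" "x dvd a"
  shows "x = a"
proof -
  obtain b where b: "b \<in> A" "b dvd x"
    using interval_below[OF assms(2)] by (metis int_dvd_int_iff)
  then have "b = a"
    using assms A_primitive unfolding primitive_def by (meson dvd_trans)
  then show ?thesis using b(2) assms(3) by (simp add: dvd_antisym)
qed

text \<open>The powers of \<open>u * r\<close> with exponent a multiple of \<open>totient P\<close> do not change residues, so
  \<open>d * u * (u * r) ^ (2 * totient P)\<close> lies in \<open>H\<close>; between it and a minimal element below it there is
  a number congruent to \<open>d * r\<close>.\<close>

lemma unit_swap:
  assumes "int (d * u) \<in> H" "coprime u P" "coprime r P" "d > 0" "u > 0" "r > 0"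
  shows "int (d * r) \<in> H"
proof -
  define Q where "Q = u * r"
  define w where "w = totient P"
  have w: "w > 0" using P_pos by (simp add: w_def)
  have Q: "coprime Q P" "Q > 0" using assms by (auto simp: Q_def)
  have one: "[q ^ w = 1] (mod P)" if "coprime q P" for q
    unfolding w_def using that by (rule euler_theorem)
  have Qw: "[Q ^ w = 1] (mod P)" using one Q by blast
  define h where "h = d * u * Q ^ w * Q ^ w"
  have "[h = d * u * 1 * 1] (mod P)"
    unfolding h_def by (intro cong_mult cong_refl Qw)
  then have "int h \<in> H"
    using assms(1) cong_mem_nat cong_sym by (metis mult.right_neutral)
  then obtain a where a: "a \<in> A" "int a dvd int h"
      "\<And>x. int a dvd x \<Longrightarrow> x dvd int h \<Longrightarrow> x \<in> H"
    using interval_below by blast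
  have a0: "a > 0" using a(1) A_pos by auto
  \<comment> \<open>Minimality of \<open>a\<close> keeps its exponent at primes dividing \<open>Q\<close> below \<open>w\<close>, as \<open>q ^ w\<close> is 1 modulo \<open>P\<close>.\<close>
  have "a dvd d * Q ^ w"
  proof (rule multiplicity_le_imp_dvd)
    fix q :: nat assume q: "prime q"
    show "multiplicity q a \<le> multiplicity q (d * Q ^ w)"
    proof (cases "q dvd Q")
      case True
      then have cop: "coprime q P" using Q(1) by (meson coprime_divisors dvd_refl)
      have "\<not> q ^ w dvd a"
      proof
        assume "q ^ w dvd a"
        then obtain a' where a': "a = q ^ w * a'" by blast
        have "[q ^ w * a' = 1 * a'] (mod P)"
          by (intro cong_mult cong_refl one cop)
        then have "int a' \<in> H"
          using A_subset[OF a(1)] cong_mem_nat unfolding a' by simp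
        then have "a' = a" using minimal[OF a(1)] a' by simp
        then have "q ^ w = 1" using a' a0 by simp
        then show False using w q prime_gt_1_nat[OF q] by simp
      qed
      then have "multiplicity q a < w" 
        using multiplicity_dvd' by (meson not_le)
      also have "w \<le> multiplicity q (d * Q ^ w)"
        using True q assms(4) Q(2)
        by (intro multiplicity_geI) (auto intro: dvd_mult dvd_power_same)
      finally show ?thesis by simp
    next
      case False
      then have "\<not> q dvd u * Q ^ w * Q ^ w"
        using q by (simp add: prime_dvd_mult_iff prime_dvd_power_iff w Q_def)
      then have "multiplicity q h = multiplicity q d"
        unfolding h_def mult.assoc using q assms(4)
        by (subst prime_elem_multiplicity_mult_distrib)
           (use Q(2) assms(5) in \<open>auto simp: not_dvd_imp_multiplicity_0\<close>)
      moreover have "multiplicity q a \<le> multiplicity q h"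
        using a(2) Q(2) assms(4,5) unfolding int_dvd_int_iff
        by (intro dvd_imp_multiplicity_le) (simp_all add: h_def)
      moreover have "multiplicity q d \<le> multiplicity q (d * Q ^ w)"
        using Q(2) assms by (intro dvd_imp_multiplicity_le) auto
      ultimately show ?thesis by simp
    qed
  qed (use a0 in simp)
  then have "int a dvd int (d * r * Q ^ w)"
    by (metis dvd_mult int_dvd_int_iff mult.assoc mult.commute)
  moreover have "h = (d * r * Q ^ w) * (u * u * Q ^ (w - 1))"
    using w unfolding h_def Q_def by (cases w) (simp_all add: algebra_simps)
  then have "int (d * r * Q ^ w) dvd int h"
    by (metis dvd_triv_left int_dvd_int_iff)
  ultimately have "int (d * r * Q ^ w) \<in> H" using a(3) by blast
  moreover have "[d * r * Q ^ w = d * r * 1] (mod P)"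
    by (intro cong_mult cong_refl Qw)
  ultimately show ?thesis using cong_mem_nat by (metis mult.right_neutral)
qed

lemma dvd_period:
  assumes "a \<in> A"
  shows "a dvd P"
proof -
  define d where "d = gcd a P"
  have a0: "a > 0" using assms A_pos by auto
  have d0: "d > 0" using P_pos by (simp add: d_def)
  have "coprime (a div d) (P div d)"
    unfolding d_def using P_pos by (intro div_gcd_coprime) simp
  then obtain u where u: "coprime u P" "[u = a div d] (mod (P div d))"
    using coprime_residue_lift[of "a div d" "P div d" P] P_pos
    by (metis d_def div_dvd_iff_mult dvd_div_mult_self dvd_triv_left gcd_dvd2 gcd_eq_0_iff less_irrefl)
  have "P div d dvd P" by (metis d_def dvd_div_mult_self dvd_triv_left gcd_dvd2)
  then have "[u + P = a div d] (mod (P div d))"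
    using u(2) by (metis cong_add_rcancel_0_nat cong_0_iff cong_trans add.commute)
  then have "[d * (u + P) = d * (a div d)] (mod (d * (P div d)))"
    by (simp add: cong_def mod_mult_mult1)
  then have "[d * (u + P) = a] (mod P)" by (simp add: d_def)
  then have "int (d * (u + P)) \<in> H"
    using A_subset[OF assms] cong_mem_nat cong_sym by blast
  then have "int (d * 1) \<in> H"
    by (rule unit_swap) (use u(1) P_pos d0 in \<open>simp_all add: coprime_iff_gcd_eq_1\<close>)
  then have "d = a" using minimal[OF assms] by (simp add: d_def)
  then show ?thesis by (metis d_def gcd_dvd2)
qed

lemma finite_A: "finite A"
  using dvd_period P_pos by (intro finite_subset[OF _ finite_divisors_nat[of P]]) auto

lemma unit_mult_mem:
  assumes "int d \<in> H" "coprime r P" "d > 0" "r > 0"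
  shows "int (d * r) \<in> H"
  using unit_swap[of d 1 r] assms by auto

lemma dvd_translation:
  fixes h N :: nat and z :: int
  assumes a: "a \<in> A" "a dvd h" "\<And>x. a dvd x \<Longrightarrow> x dvd h \<Longrightarrow> int x \<in> H"
    and N: "N dvd P"
    and small: "(\<Sum>a'\<in>A - {a}. 1 / real (totient (a' div gcd a' a))) < 1 / (real N)\<^sup>2"
    and cover: "\<And>h'. int h' \<in> H \<Longrightarrow> [h' = h] (mod N) \<Longrightarrow> \<exists>a'\<in>A. int a' dvd int h' + z"
  shows "int a dvd z"
proof -
  have N0: "N > 0" using N P_pos dvd_pos_nat by blast
  have a0: "a > 0" using a(1) A_pos by auto
  define b where "b = h div a"
  define \<beta> where "\<beta> = gcd b N"
  define Q where "Q = N div \<beta>"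
  define c where "c = b div \<beta>"
  have h: "h = a * b" using a(2) by (simp add: b_def)
  have \<beta>: "\<beta> > 0" "\<beta> \<le> N" "b = \<beta> * c" "N = \<beta> * Q"
    using N0 by (auto simp: \<beta>_def c_def Q_def intro: dvd_imp_le)
  have cQ: "coprime c Q"
    unfolding c_def Q_def \<beta>_def using N0 by (intro div_gcd_coprime) simp
  have QP: "Q dvd P" using N \<beta>(4) by (metis dvd_mult_right)
  have "totient Q \<le> N"
    using totient_le[of Q] \<beta>(1,4) N0 by (metis dvd_imp_le dvd_triv_right le_trans)
  define q where "q = (\<lambda>a'. a' div gcd a' (a * \<beta>))"
  define v where "v = (\<lambda>a'. SOME r. int a' dvd int (a * \<beta> * r) + z)"
  have q: "q a' dvd a'" "a' > 0" "q a' dvd P" if "a' \<in> A" for a'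
  proof -
    show "q a' dvd a'"
      unfolding q_def by (metis dvd_div_mult_self dvd_triv_left gcd_dvd1)
    then show "q a' dvd P" using dvd_period[OF that] dvd_trans by blast
    show "a' > 0" using that A_pos by auto
  qed
  have "(\<Sum>a'\<in>A - {a}. real (totient Q) / real (totient (q a')))
      \<le> (\<Sum>a'\<in>A - {a}. (real N)\<^sup>2 * (1 / real (totient (a' div gcd a' a))))"
  proof (rule sum_mono)
    fix a' assume a': "a' \<in> A - {a}"
    then have "a' > 0" using q by blast
    have pos: "totient (q a') > 0" "totient (a' div gcd a' a) > 0"
      using \<open>a' > 0\<close> q(1)[of a'] a'
      by (auto simp: dvd_pos_nat) (metis dvd_div_eq_0_iff gcd_dvd1 gr0I less_irrefl)
    have "totient (a' div gcd a' a) \<le> \<beta> * totient (q a')"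
      unfolding q_def using \<open>a' > 0\<close> \<beta>(1) by (rule totient_div_gcd_le)
    also have "\<dots> \<le> N * totient (q a')" using \<beta>(2) by simp
    finally have "totient Q * totient (a' div gcd a' a) \<le> N * (N * totient (q a'))"
      using \<open>totient Q \<le> N\<close> by (rule mult_le_mono[rotated])
    then have "real (totient Q) * real (totient (a' div gcd a' a)) \<le> (real N)\<^sup>2 * real (totient (q a'))"
      by (simp only: power2_eq_square of_nat_mult[symmetric] of_nat_le_iff mult.assoc)
    then show "real (totient Q) / real (totient (q a')) \<le> (real N)\<^sup>2 * (1 / real (totient (a' div gcd a' a)))"
      using pos by (simp add: divide_simps)
  qed
  also have "\<dots> < 1"
    using small N0 unfolding sum_distrib_left[symmetric]
    by (subst (asm) pos_less_divide_eq) (simp_all add: mult.commute)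
  finally obtain r where r: "coprime r P" "[r = c] (mod Q)"
      "\<And>a'. a' \<in> A - {a} \<Longrightarrow> \<not> [r = v a'] (mod q a')"
    using coprime_avoiding_residues[OF P_pos QP cQ, of "A - {a}" q v] finite_A q by blast
  define h' where "h' = a * \<beta> * r"
  have "int (a * \<beta>) \<in> H"
    using h \<beta>(3) by (intro a(3)) auto
  then have "int (a * \<beta> * (r + P)) \<in> H"
    using unit_mult_mem[of "a * \<beta>" "r + P"] r(1) a0 \<beta>(1) P_pos by (simp add: coprime_iff_gcd_eq_1)
  moreover have "[a * \<beta> * (r + P) = h'] (mod P)"
    by (simp add: h'_def cong_def algebra_simps)
  ultimately have "int h' \<in> H" using cong_mem_nat by blast
  moreover have "[h' = h] (mod N)"
  proof -
    have "[\<beta> * r = \<beta> * c] (mod N)"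
      using r(2) by (simp add: \<beta>(4) cong_def mod_mult_mult1)
    from cong_scalar_left[OF this, of a] show ?thesis
      by (simp only: h'_def h \<beta>(3) mult.assoc)
  qed
  ultimately obtain a' where a': "a' \<in> A" "int a' dvd int h' + z"
    using cover by blast
  have "a' = a"
  proof (rule ccontr)
    assume "a' \<noteq> a"
    have "int a' dvd int (a * \<beta> * v a') + z"
      unfolding v_def by (rule someI[of _ r]) (use a'(2) h'_def in simp)
    then have "int a' dvd int h' - int (a * \<beta> * v a')"
      using a'(2) by (metis add_diff_cancel_right dvd_diff)
    then have "[a * \<beta> * r = a * \<beta> * v a'] (mod a')"
      by (simp add: cong_iff_dvd_diff h'_def flip: cong_int_iff)
    then have "[r = v a'] (mod q a')"
      unfolding q_def using q(2)[OF a'(1)] by (rule cong_cancel_div_gcd)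
    then show False using r(3)[of a'] a'(1) \<open>a' \<noteq> a\<close> by simp
  qed
  moreover have "int a dvd int h'" by (simp add: h'_def)
  ultimately show ?thesis using a'(2) by (simp add: dvd_add_right_iff)
qed

end

section \<open>Holes and the boundary of the window\<close>

lemma compact_closed_nest:
  fixes C :: "nat \<Rightarrow> 'a :: topological_space set"
  assumes "compact D" "\<And>n. closed (C n)" "\<And>n. D \<inter> C n \<noteq> {}"
    and "\<And>m n. m \<le> n \<Longrightarrow> D \<inter> C n \<subseteq> C m"
  shows "\<exists>x\<in>D. \<forall>n. x \<in> C n"
proof -
  have "D \<inter> (\<Inter>n\<in>UNIV. C n) \<noteq> {}"
  proof (rule compact_imp_fip_image[OF assms(1)])
    fix I :: "nat set" assume I: "finite I"
    then obtain n where n: "\<And>i. i \<in> I \<Longrightarrow> i \<le> n" by (meson finite_nat_set_iff_bounded_le)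
    obtain x where "x \<in> D" "x \<in> C n" using assms(3)[of n] by blast
    then have "x \<in> D \<inter> (\<Inter>i\<in>I. C i)" using assms(4) n by blast
    then show "D \<inter> (\<Inter>i\<in>I. C i) \<noteq> {}" by blast
  qed (use assms(2) in auto)
  then show ?thesis by auto
qed

lemma closed_coordinate: "closed {g :: 'a \<Rightarrow> 'b :: discrete_topology. g i \<in> C}"
proof -
  have "closed ((\<lambda>g :: 'a \<Rightarrow> 'b. g i) -` C)"
    by (intro closed_vimage continuous_on_product_coordinates) (simp add: closed_def open_discrete)
  then show ?thesis by (simp add: vimage_def)
qed

lemma open_coordinate: "open {g :: 'a \<Rightarrow> 'b :: discrete_topology. g i \<in> C}"
proof -
  have "open ((\<lambda>g :: 'a \<Rightarrow> 'b. g i) -` C)"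
    by (intro open_vimage continuous_on_product_coordinates) (simp add: open_discrete)
  then show ?thesis by (simp add: vimage_def)
qed

lemma compact_binary_sequences: "compact (UNIV :: ('a \<Rightarrow> bool) set)"
proof -
  have "compact_space (euclidean :: ('a \<Rightarrow> bool) topology)"
    unfolding euclidean_product_topology[symmetric]
    by (intro compact_space_product_topology[THEN iffD2]) (simp add: compact_space_def finite_imp_compact)
  then show ?thesis by (simp add: compact_space_def)
qed

lemma continuous_on_shift_by: "continuous_on U (shift_by k)"
  unfolding shift_by_def
  by (intro continuous_on_coordinatewise_then_product continuous_on_product_coordinates[THEN continuous_on_subset]) auto

lemma shift_by_add: "shift_by j (shift_by k x) = shift_by (j + k) x"
  by (simp add: shift_by_def add_ac)

lemma odo_dvd_iff: "t dvd N \<Longrightarrow> odo_dvd N t x \<longleftrightarrow> int t dvd x"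
proof
  assume "t dvd N" "odo_dvd N t x"
  then obtain w where "[x = int t * w] (mod int N)" by (auto simp: odo_dvd_def)
  then have "[x = int t * w] (mod int t)"
    using \<open>t dvd N\<close> by (meson cong_dvd_modulus int_dvd_int_iff)
  then show "int t dvd x"
    by (simp add: cong_dvd_iff)
qed (metis cong_refl dvdE odo_dvd_def)

lemma minimal_period_dvd:
  assumes "q > 0" "\<And>k. k + int q \<in> H \<longleftrightarrow> k \<in> H" and z: "\<And>k. k + z \<in> H \<longleftrightarrow> k \<in> H"
  shows "int (minimal_period H) dvd z"
proof -
  define per where "per = (\<lambda>t :: int. \<forall>k. k + t \<in> H \<longleftrightarrow> k \<in> H)"
  define t where "t = minimal_period H"
  have t: "t > 0" "per (int t)"
    using LeastI[of "\<lambda>t. t > 0 \<and> per (int t)" q] assms(1,2)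
    unfolding t_def minimal_period_def per_def by blast+
  have least: "t \<le> s" if "s > 0" "per (int s)" for s
    unfolding t_def minimal_period_def using that unfolding per_def by (intro Least_le) blast
  have "k + j * int t \<in> H \<longleftrightarrow> k \<in> H" for k j
  proof (induction j rule: int_induct[where k = 0])
    case (step1 i)
    then show ?case
      using t(2)[unfolded per_def, rule_format, of "k + i * int t"] by (simp add: algebra_simps)
  next
    case (step2 i)
    then show ?case
      using t(2)[unfolded per_def, rule_format, of "k + (i - 1) * int t"] by (simp add: algebra_simps)
  qed simp
  then have "k + z mod int t + (z div int t) * int t \<in> H \<longleftrightarrow> k + z mod int t \<in> H" for k
    by blast
  moreover have "k + z mod int t + (z div int t) * int t = k + z" for k
    by (metis add.assoc mod_mult_div_eq add.commute mult.commute)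
  ultimately have "per (z mod int t)"
    using z by (simp add: per_def)
  moreover have "0 \<le> z mod int t" "z mod int t < int t"
    using t(1) by simp_all
  ultimately have "z mod int t = 0"
    using least[of "nat (z mod int t)"] by (cases "z mod int t = 0") auto
  then show ?thesis unfolding t_def by auto
qed

lemma Hausdorff_space_discrete_fun:
  "Hausdorff_space (euclidean :: ('i \<Rightarrow> 'b :: discrete_topology) topology)"
proof -
  have "Hausdorff_space (euclidean :: 'b topology)"
    unfolding Hausdorff_space_def
  proof (intro allI impI)
    fix x y :: 'b assume "x \<in> topspace euclidean \<and> y \<in> topspace euclidean \<and> x \<noteq> y"
    then show "\<exists>U V. openin euclidean U \<and> openin euclidean V \<and> x \<in> U \<and> y \<in> V \<and> disjnt U V"
      by (intro exI[of _ "{x}"] exI[of _ "{y}"]) (simp add: open_discrete)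
  qed
  then have "Hausdorff_space (product_topology (\<lambda>_ :: 'i. euclidean :: 'b topology) UNIV)"
    by (intro Hausdorff_space_product_topology[THEN iffD2] disjI2 ballI)
  then show ?thesis by (simp only: euclidean_product_topology)
qed

locale toeplitz_odometer =
  fixes \<eta> :: "int \<Rightarrow> bool" and p :: "nat \<Rightarrow> nat" and \<pi> :: "(int \<Rightarrow> bool) \<Rightarrow> (nat \<Rightarrow> int)"
  assumes toeplitz: "toeplitz \<eta> p"
    and mef: "max_equicontinuous_factor (orbit_closure \<eta>) shift (top_of_set (odo p)) (odo_T p) \<pi>"
    and base_point: "\<pi> \<eta> = odo_Delta p 0"
begin

abbreviation "B \<equiv> window_boundary \<eta> p"
abbreviation "X \<equiv> closure (range (\<lambda>k. shift_by k \<eta>))"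

lemmas p_pos = toeplitz_pos[OF toeplitz]
lemmas p_dvd = toeplitz_dvd[OF toeplitz]
lemmas Delta_odo [simp] = odo_Delta_in_odo[OF toeplitz]

lemma odo_range: "g \<in> odo p \<Longrightarrow> 1 \<le> n \<Longrightarrow> 0 \<le> g n \<and> g n < int (p n)"
  by (auto simp: odo_def dest: PiE_mem)

lemma odo_eqI:
  assumes "g \<in> odo p" "h \<in> odo p" "\<And>n. 1 \<le> n \<Longrightarrow> g n = h n"
  shows "g = h"
proof
  fix n show "g n = h n"
    using assms by (cases "1 \<le> n") (auto simp: odo_def PiE_def extensional_def)
qed

lemma odo_add_nth: "1 \<le> n \<Longrightarrow> odo_add p g h n = (g n + h n) mod int (p n)"
  by (simp add: odo_add_def)

lemma odo_diff_nth: "1 \<le> n \<Longrightarrow> odo_diff p g h n = (g n - h n) mod int (p n)"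
  by (simp add: odo_diff_def)

lemma odo_Delta_nth: "1 \<le> n \<Longrightarrow> odo_Delta p k n = k mod int (p n)"
  by (simp add: odo_Delta_def)

lemma odo_coherent_in_odo:
  assumes "\<And>n. 1 \<le> n \<Longrightarrow> [f (Suc n) = f n] (mod int (p n))"
  shows "restrict (\<lambda>n. f n mod int (p n)) {1..} \<in> odo p"
proof -
  have "f (Suc n) mod int (p (Suc n)) mod int (p n) = f n mod int (p n)" if "1 \<le> n" for n
    using assms[OF that] p_dvd[of n "Suc n"] that
    by (simp add: mod_mod_cancel cong_def)
  then show ?thesis using p_pos by (auto simp: odo_def)
qed

lemma odo_cong_Suc: "g \<in> odo p \<Longrightarrow> 1 \<le> n \<Longrightarrow> [g (Suc n) = g n] (mod int (p n))"
  using odo_range[of g n] by (auto simp: odo_def cong_def)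

lemma odo_add_odo [simp]: "g \<in> odo p \<Longrightarrow> h \<in> odo p \<Longrightarrow> odo_add p g h \<in> odo p"
  unfolding odo_add_def by (intro odo_coherent_in_odo cong_add odo_cong_Suc)

lemma odo_diff_odo [simp]: "g \<in> odo p \<Longrightarrow> h \<in> odo p \<Longrightarrow> odo_diff p g h \<in> odo p"
  unfolding odo_diff_def by (intro odo_coherent_in_odo cong_diff odo_cong_Suc)

lemma constant_places_cong:
  assumes "[k = l] (mod int (p n))" "k \<in> constant_places \<eta> p i n"
  shows "l \<in> constant_places \<eta> p i n"
proof -
  obtain t where t: "l = k + int (p n) * t" using assms(1) by (auto simp: cong_iff_lin)
  have "l + j * int (p n) = k + (t + j) * int (p n)" for j
    by (simp add: t algebra_simps)
  then show ?thesis using assms(2) by (simp add: constant_places_def)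
qed

lemma holes_cong: "[k = l] (mod int (p n)) \<Longrightarrow> k \<in> holes \<eta> p n \<longleftrightarrow> l \<in> holes \<eta> p n"
  using constant_places_cong cong_sym unfolding holes_def by blast

lemma mod_mem_holes [simp]: "k mod int (p n) \<in> holes \<eta> p n \<longleftrightarrow> k \<in> holes \<eta> p n"
  by (rule holes_cong) simp

lemma B_iff: "g \<in> B \<longleftrightarrow> g \<in> odo p \<and> (\<forall>n\<ge>1. g n \<in> holes \<eta> p n)"
  using V_set_iff[OF toeplitz] unfolding window_boundary_eq[OF toeplitz] holes_def by blast

lemma B_odo: "g \<in> B \<Longrightarrow> g \<in> odo p"
  by (simp add: B_iff)

lemma holes_antimono:
  assumes "g \<in> odo p" "1 \<le> n" "n \<le> n'" "g n' \<in> holes \<eta> p n'"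
  shows "g n \<in> holes \<eta> p n"
  using assms constant_places_mono[OF toeplitz assms(1-3)] unfolding holes_def by blast

lemma compact_odo: "compact (odo p)"
proof -
  have "compact_space (top_of_set (odo p))"
    using mef unfolding max_equicontinuous_factor_def equicontinuous_system_def dynamical_system_def
    by blast
  then show ?thesis by (simp add: compact_space_subtopology compact_space_def compactin_subtopology)
qed

lemma holes_coordinate_closed: "closed (\<Inter>n\<in>{1..}. {g :: nat \<Rightarrow> int. f n (g n) \<in> holes \<eta> p n})"
proof (intro closed_INT ballI)
  fix n
  show "closed {g :: nat \<Rightarrow> int. f n (g n) \<in> holes \<eta> p n}"
    using closed_coordinate[of n "{x. f n x \<in> holes \<eta> p n}"] by simp
qed

lemma compact_B: "compact B"
proof -
  have "B = odo p \<inter> (\<Inter>n\<in>{1..}. {g. g n \<in> holes \<eta> p n})"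
    by (auto simp: B_iff)
  then show ?thesis
    using compact_Int_closed[OF compact_odo holes_coordinate_closed[of "\<lambda>n x. x"]] by simp
qed

lemma closedin_translate:
  assumes "z \<in> odo p"
  shows "closedin (top_of_set B) {h \<in> B. odo_add p h z \<in> B}"
proof -
  have "{h \<in> B. odo_add p h z \<in> B} =
      B \<inter> (\<Inter>n\<in>{1..}. {g. (g n + z n) mod int (p n) \<in> holes \<eta> p n})"
    using assms by (auto simp: B_iff odo_add_nth)
  then show ?thesis
    using closedin_closed_Int[OF holes_coordinate_closed[of "\<lambda>n x. (x + z n) mod int (p n)"], of B]
    by simp
qed

lemma essential_holes_iff:
  assumes "1 \<le> n"
  shows "k \<in> essential_holes \<eta> p n \<longleftrightarrow> (\<exists>g\<in>B. g n = k mod int (p n))"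
proof
  assume k: "k \<in> essential_holes \<eta> p n"
  define C where "C = (\<lambda>m. {g. g n \<in> {k mod int (p n)}} \<inter> {g. g (n + m) \<in> holes \<eta> p (n + m)})"
  have "\<exists>g\<in>odo p. \<forall>m. g \<in> C m"
  proof (rule compact_closed_nest[OF compact_odo])
    show "closed (C m)" for m
      unfolding C_def by (intro closed_Int closed_coordinate)
    show "odo p \<inter> C m \<noteq> {}" for m
    proof -
      obtain j where j: "k + j * int (p n) \<in> holes \<eta> p (n + m)"
        using k unfolding essential_holes_def by (auto dest!: spec[of _ "n + m"])
      have "odo_Delta p (k + j * int (p n)) \<in> C m"
        using assms j by (simp add: C_def odo_Delta_nth)
      then show ?thesis by force
    qed
    show "odo p \<inter> C m' \<subseteq> C m" if "m \<le> m'" for m m'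
      using that assms holes_antimono[of _ "n + m" "n + m'"] by (auto simp: C_def)
  qed
  then obtain g where g: "g \<in> odo p" "\<And>m. g \<in> C m" by blast
  have "g n' \<in> holes \<eta> p n'" if "1 \<le> n'" for n'
    using g(2)[of n'] holes_antimono[OF g(1) that, of "n + n'"] by (auto simp: C_def)
  then show "\<exists>g\<in>B. g n = k mod int (p n)"
    using g by (intro bexI[of _ g]) (auto simp: B_iff C_def)
next
  assume "\<exists>g\<in>B. g n = k mod int (p n)"
  then obtain g where g: "g \<in> odo p" "\<And>n. 1 \<le> n \<Longrightarrow> g n \<in> holes \<eta> p n" "g n = k mod int (p n)"
    by (auto simp: B_iff)
  have "k \<in> holes \<eta> p n"
    using g(2)[OF assms] g(3) by simp
  moreover have "holes \<eta> p n' \<inter> range (\<lambda>j. k + j * int (p n)) \<noteq> {}" if "n \<le> n'" for n'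
  proof -
    have "[k = g n'] (mod int (p n))"
      using odo_mod[OF toeplitz g(1) assms that] g(3) by (simp add: cong_def)
    then obtain j where "g n' = k + j * int (p n)"
      by (metis cong_iff_lin mult.commute)
    then show ?thesis using g(2)[of n'] assms that by auto
  qed
  ultimately show "k \<in> essential_holes \<eta> p n"
    by (simp add: essential_holes_def)
qed

lemma essential_holes_nth: "g \<in> B \<Longrightarrow> 1 \<le> n \<Longrightarrow> g n \<in> essential_holes \<eta> p n"
  using odo_range[OF B_odo, of g n] by (auto simp: essential_holes_iff)

lemma essential_holes_cong:
  "1 \<le> n \<Longrightarrow> [k = l] (mod int (p n)) \<Longrightarrow> k \<in> essential_holes \<eta> p n \<longleftrightarrow> l \<in> essential_holes \<eta> p n"
  by (simp add: essential_holes_iff cong_def)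

lemma essential_holes_antimono:
  assumes "1 \<le> n" "n \<le> n'"
  shows "essential_holes \<eta> p n' \<subseteq> essential_holes \<eta> p n"
proof
  fix k assume "k \<in> essential_holes \<eta> p n'"
  then obtain g where g: "g \<in> B" "g n' = k mod int (p n')"
    using assms by (auto simp: essential_holes_iff)
  then have "g n = k mod int (p n)"
    using odo_mod[OF toeplitz B_odo[OF g(1)] assms] p_dvd[OF assms] by (simp add: mod_mod_cancel)
  then show "k \<in> essential_holes \<eta> p n"
    using g(1) assms(1) by (auto simp: essential_holes_iff)
qed

lemma Delta_notin_B: "odo_Delta p k \<notin> B"
proof
  assume "odo_Delta p k \<in> B"
  obtain n where n: "n \<ge> 1" "\<And>j. \<eta> (k + j * int (p n)) = \<eta> k"
    using toeplitz unfolding toeplitz_def by blast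
  then have "k \<in> constant_places \<eta> p (\<eta> k) n" by (simp add: constant_places_def)
  then have "k \<notin> holes \<eta> p n" unfolding holes_def by (cases "\<eta> k") auto
  then show False
    using \<open>odo_Delta p k \<in> B\<close> n(1) holes_cong[of "k mod int (p n)" k n]
    by (auto simp: B_iff odo_Delta_nth)
qed

lemma essential_holes_eventually: "\<exists>n0. \<forall>n\<ge>n0. k \<notin> essential_holes \<eta> p n"
proof -
  obtain n where n: "n \<ge> 1" "odo_Delta p k n \<notin> holes \<eta> p n"
    using Delta_notin_B[of k] by (auto simp: B_iff)
  then have "k \<notin> essential_holes \<eta> p n"
    by (simp add: odo_Delta_nth essential_holes_def)
  then show ?thesis
    using essential_holes_antimono[OF n(1)] by blast
qed

lemma B_nonempty: "B \<noteq> {}"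
proof
  assume empty: "B = {}"
  define C where "C = (\<lambda>m. {g. g (Suc m) \<in> holes \<eta> p (Suc m)})"
  have "\<exists>m. odo p \<inter> C m = {}"
  proof (rule ccontr)
    assume "\<nexists>m. odo p \<inter> C m = {}"
    then have "\<exists>g\<in>odo p. \<forall>m. g \<in> C m"
      by (intro compact_closed_nest[OF compact_odo])
         (auto simp: C_def closed_coordinate intro: holes_antimono[of _ "Suc _" "Suc _"])
    then obtain g where g: "g \<in> odo p" "\<And>m. g \<in> C m" by blast
    have "g n \<in> holes \<eta> p n" if "1 \<le> n" for n
      using g(2)[of "n - 1"] that by (simp add: C_def)
    then have "g \<in> B" using g(1) by (simp add: B_iff)
    then show False using empty by blast
  qed
  then obtain m where m: "odo p \<inter> C m = {}" by blast
  have "\<eta> (k + int (p (Suc m))) = \<eta> k" for k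
  proof -
    have "odo_Delta p k \<notin> C m" using m Delta_odo by blast
    then have "k \<notin> holes \<eta> p (Suc m)"
      by (simp add: C_def odo_Delta_nth)
    then obtain i where "\<And>j. \<eta> (k + j * int (p (Suc m))) = i"
      by (auto simp: holes_def constant_places_def)
    from this[of 0] this[of 1] show ?thesis by simp
  qed
  moreover have "int (p (Suc m)) > 0" using p_pos by simp
  ultimately show False using toeplitz unfolding toeplitz_def by blast
qed

section \<open>Fibres of the factor map and automorphisms\<close>

lemma topspace_X [simp]: "topspace (orbit_closure \<eta>) = X"
  by (simp add: orbit_closure_def)

lemma compact_X: "compact X"
  using compact_Int_closed[OF compact_binary_sequences, of X] by simp

lemma eta_in_X [simp]: "\<eta> \<in> X"
proof -
  have "\<eta> = shift_by 0 \<eta>" by (simp add: shift_by_def)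
  then show ?thesis by (metis closure_subset rangeI subset_iff)
qed

lemma shift_in_X [simp]:
  assumes "x \<in> X"
  shows "shift_by k x \<in> X"
proof -
  have "shift_by k ` X \<subseteq> closure (shift_by k ` range (\<lambda>k. shift_by k \<eta>))"
    using continuous_on_shift_by by (rule image_closure_subset) (simp_all add: closure_subset)
  also have "\<dots> \<subseteq> X"
    by (intro closure_mono) (auto simp: shift_by_add)
  finally show ?thesis using assms by blast
qed

lemma factor: "continuous_on X \<pi>" "\<pi> ` X = odo p" "x \<in> X \<Longrightarrow> \<pi> (shift x) = odo_T p (\<pi> x)"
  using mef unfolding max_equicontinuous_factor_def factor_map_def orbit_closure_def
  by (auto simp: continuous_map_in_subtopology)

lemma pi_odo [simp]: "x \<in> X \<Longrightarrow> \<pi> x \<in> odo p"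
  using factor(2) by blast

lemma pi_shift:
  assumes "x \<in> X"
  shows "\<pi> (shift_by k x) = odo_add p (\<pi> x) (odo_Delta p k)"
proof (rule odo_eqI)
  fix n :: nat assume n: "1 \<le> n"
  have step: "\<pi> (shift_by (i + 1) x) n = (\<pi> (shift_by i x) n + 1) mod int (p n)" for i
    using factor(3)[of "shift_by i x"] assms n
    by (simp add: shift_by_add odo_T_def odo_add_nth odo_Delta_nth mod_simps add.commute)
  have "\<pi> (shift_by k x) n = (\<pi> x n + k) mod int (p n)"
  proof (induction k rule: int_induct[where k = 0])
    case base
    show ?case using odo_range[OF pi_odo[OF assms] n] by (simp add: shift_by_def)
  next
    case (step1 i)
    then show ?case using step[of i] by (simp add: mod_add_left_eq add.assoc)
  next
    case (step2 i)
    have "\<pi> (shift_by (i - 1) x) n = (\<pi> (shift_by (i - 1) x) n + 1 - 1) mod int (p n)"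
      using odo_range[OF pi_odo, of "shift_by (i - 1) x" n] assms n by simp
    also have "\<dots> = (\<pi> x n + i - 1) mod int (p n)"
      using step[of "i - 1"] step2 by (metis diff_add_cancel mod_diff_left_eq)
    finally show ?case by (simp add: algebra_simps)
  qed
  then show "\<pi> (shift_by k x) n = odo_add p (\<pi> x) (odo_Delta p k) n"
    using n by (simp add: odo_add_nth odo_Delta_nth mod_add_right_eq)
qed (use assms in auto)

lemma pi_eta: "\<pi> (shift_by k \<eta>) = odo_Delta p k"
  by (rule odo_eqI) (simp_all add: pi_shift base_point odo_add_nth odo_Delta_nth)

lemma orbit_meets_open:
  assumes "x \<in> U" "openin (top_of_set X) U"
  obtains k where "shift_by k \<eta> \<in> U"
proof -
  obtain T where T: "open T" "U = X \<inter> T"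
    using assms(2) by (auto simp: openin_open)
  then obtain k where "shift_by k \<eta> \<in> T"
    using assms(1) open_Int_closure_eq_empty[of T "range (\<lambda>k. shift_by k \<eta>)"] by blast
  then show ?thesis using that T(2) shift_in_X[OF eta_in_X] by blast
qed

lemma openin_coordinate:
  fixes f :: "(int \<Rightarrow> bool) \<Rightarrow> ('i \<Rightarrow> 'b :: discrete_topology)"
  assumes "continuous_on X f"
  shows "openin (top_of_set X) {x \<in> X. f x i = c}"
proof -
  have "openin (top_of_set X) (X \<inter> f -` {g. g i \<in> {c}})"
    using assms open_coordinate by (rule continuous_openin_preimage_gen)
  moreover have "X \<inter> f -` {g. g i \<in> {c}} = {x \<in> X. f x i = c}" by auto
  ultimately show ?thesis by simp
qed

lemma approximation:
  assumes "x \<in> X" "1 \<le> n"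
  obtains k where "\<eta> (k + s) = x s" "\<pi> x n = k mod int (p n)"
proof -
  define U where "U = {w \<in> X. \<pi> w n = \<pi> x n} \<inter> {w \<in> X. w s = x s}"
  have "openin (top_of_set X) U"
    unfolding U_def
    by (intro openin_Int openin_coordinate[where f = \<pi>] factor(1) openin_coordinate[where f = "\<lambda>w. w"]
        continuous_on_id)
  moreover have "x \<in> U" using assms by (simp add: U_def)
  ultimately obtain k where k: "shift_by k \<eta> \<in> U"
    using orbit_meets_open by metis
  show ?thesis
  proof
    show "\<eta> (k + s) = x s" using k by (simp add: U_def shift_by_def add.commute)
    show "\<pi> x n = k mod int (p n)" using k assms(2) by (simp add: U_def pi_eta odo_Delta_nth)
  qed
qed

lemma value_of_constant_place:
  assumes "x \<in> X" "1 \<le> n" "\<pi> x n + s \<in> constant_places \<eta> p i n"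
  shows "x s = i"
proof -
  obtain k where k: "\<eta> (k + s) = x s" "\<pi> x n = k mod int (p n)"
    using approximation[OF assms(1,2)] .
  have "[\<pi> x n + s = k + s] (mod int (p n))"
    by (simp add: k(2) cong_def mod_add_left_eq)
  then have "k + s \<in> constant_places \<eta> p i n"
    using assms(3) by (rule constant_places_cong)
  then have "\<eta> (k + s + 0 * int (p n)) = i"
    unfolding constant_places_def by blast
  then show ?thesis using k(1) by simp
qed

lemma distinct_values_in_B:
  assumes "x \<in> X" "x' \<in> X" "\<pi> x = \<pi> x'" "x s \<noteq> x' s"
  shows "odo_add p (\<pi> x) (odo_Delta p s) \<in> B"
proof -
  have "(\<pi> x n + s) mod int (p n) \<in> holes \<eta> p n" if n: "1 \<le> n" for n
  proof -
    have "\<pi> x n + s \<notin> constant_places \<eta> p i n" for i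
      using value_of_constant_place[OF assms(1) n, of s i]
        value_of_constant_place[OF assms(2) n, of s i] assms(3,4) by auto
    then have "\<pi> x n + s \<in> holes \<eta> p n" by (simp add: holes_def)
    then show ?thesis by simp
  qed
  then show ?thesis
    using assms(1) by (simp add: B_iff odo_add_nth odo_Delta_nth mod_add_right_eq)
qed

lemma fibre_value:
  assumes "g \<in> B"
  obtains x where "x \<in> X" "\<pi> x = g" "x 0 = i"
proof -
  define C where "C = (\<lambda>m. X \<inter> \<pi> -` {h. h (Suc m) \<in> {g (Suc m)}} \<inter> {x. x 0 \<in> {i}})"
  have "\<exists>x\<in>X. \<forall>m. x \<in> C m"
  proof (rule compact_closed_nest[OF compact_X])
    show "closed (C m)" for m
      unfolding C_def using factor(1)
      by (intro closed_Int closed_coordinate continuous_closed_preimage) auto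
    show "X \<inter> C m \<noteq> {}" for m
    proof -
      have "g (Suc m) \<in> holes \<eta> p (Suc m)" using assms by (simp add: B_iff)
      then obtain j where "\<eta> (g (Suc m) + j * int (p (Suc m))) = i"
        unfolding holes_def constant_places_def by (cases i) auto
      then have "shift_by (g (Suc m) + j * int (p (Suc m))) \<eta> 0 = i"
        by (simp add: shift_by_def)
      then have "shift_by (g (Suc m) + j * int (p (Suc m))) \<eta> \<in> C m"
        using odo_range[OF B_odo[OF assms], of "Suc m"]
        by (simp add: C_def pi_eta odo_Delta_nth)
      then show ?thesis unfolding C_def by blast
    qed
    show "X \<inter> C n \<subseteq> C m" if "m \<le> n" for m n
    proof
      fix x assume x: "x \<in> X \<inter> C n"
      then have "\<pi> x (Suc m) = g (Suc m)"
        using odo_mod[OF toeplitz pi_odo, of x "Suc m" "Suc n"]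
          odo_mod[OF toeplitz B_odo[OF assms], of "Suc m" "Suc n"] that by (simp add: C_def)
      then show "x \<in> C m" using x by (simp add: C_def)
    qed
  qed
  then obtain x where x: "x \<in> X" "\<And>m. x \<in> C m" by blast
  have "\<pi> x n = g n" if "1 \<le> n" for n
    using x(2)[of "n - 1"] that by (simp add: C_def)
  then have "\<pi> x = g" using odo_eqI[OF pi_odo[OF x(1)] B_odo[OF assms]] by blast
  then show ?thesis using that x x(2)[of 0] by (simp add: C_def)
qed

lemma fibre_over_Delta:
  assumes "x \<in> X" "\<pi> x = odo_Delta p k"
  shows "x = shift_by k \<eta>"
proof (rule ccontr)
  assume "x \<noteq> shift_by k \<eta>"
  then obtain s where "x s \<noteq> shift_by k \<eta> s" by blast
  then have "odo_add p (odo_Delta p k) (odo_Delta p s) \<in> B"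
    using distinct_values_in_B[OF assms(1) shift_in_X[OF eta_in_X]] assms(2) by (metis pi_eta)
  moreover have "odo_add p (odo_Delta p k) (odo_Delta p s) = odo_Delta p (k + s)"
    by (rule odo_eqI) (simp_all add: odo_add_nth odo_Delta_nth mod_add_eq)
  ultimately show False using Delta_notin_B by metis
qed

definition offset :: "((int \<Rightarrow> bool) \<Rightarrow> (int \<Rightarrow> bool)) \<Rightarrow> int \<Rightarrow> (nat \<Rightarrow> int)" where
  "offset F k = odo_diff p (y_of \<eta> p \<pi> F) (odo_Delta p k)"

abbreviation "aut \<equiv> automorphism (orbit_closure \<eta>) shift"

lemma automorphism_props:
  assumes "aut F"
  shows "continuous_on X F" "F ` X = X" "inj_on F X"
    and "x \<in> X \<Longrightarrow> F (shift_by k x) = shift_by k (F x)"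
proof -
  have hom: "homeomorphic_map (top_of_set X) (top_of_set X) F"
    and comm: "\<And>x. x \<in> X \<Longrightarrow> F (shift x) = shift (F x)"
    using assms by (auto simp: automorphism_def orbit_closure_def)
  show cont: "continuous_on X F" and im: "F ` X = X" and inj: "inj_on F X"
    using hom homeomorphic_imp_continuous_map[OF hom] homeomorphic_imp_surjective_map[OF hom]
      homeomorphic_imp_injective_map[OF hom]
    by (auto simp: continuous_map_in_subtopology)
  show "F (shift_by k x) = shift_by k (F x)" if x: "x \<in> X"
  proof (induction k rule: int_induct[where k = 0])
    case base
    show ?case by (simp add: shift_by_def)
  next
    case (step1 i)
    then show ?case
      using comm[of "shift_by i x"] x by (simp add: shift_by_add add.commute)
  next
    case (step2 i)
    have "shift (F (shift_by (i - 1) x)) = shift (shift_by (i - 1) (F x))"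
      using comm[of "shift_by (i - 1) x"] x step2 by (simp add: shift_by_add)
    then have "shift_by (- 1) (shift (F (shift_by (i - 1) x))) = shift_by (- 1) (shift (shift_by (i - 1) (F x)))"
      by simp
    then show ?case by (simp add: shift_by_add) (simp add: shift_by_def)
  qed
qed

lemma automorphism_in_X: "aut F \<Longrightarrow> x \<in> X \<Longrightarrow> F x \<in> X"
  using automorphism_props(2)[of F] by (metis imageI)

lemma pi_automorphism_base:
  assumes "aut F" "x \<in> X"
  shows "\<pi> (F x) = odo_add p (\<pi> x) (\<pi> (F \<eta>))"
proof (rule odo_eqI)
  note F = automorphism_props[OF assms(1)]
  note FX = automorphism_in_X[OF assms(1)]
  show "\<pi> (F x) \<in> odo p" "odo_add p (\<pi> x) (\<pi> (F \<eta>)) \<in> odo p"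
    using assms(2) FX by auto
  fix n :: nat assume n: "1 \<le> n"
  define U where "U = {w \<in> X. (\<pi> \<circ> F) w n = \<pi> (F x) n} \<inter> {w \<in> X. \<pi> w n = \<pi> x n}"
  have "continuous_on X (\<pi> \<circ> F)"
    using F(1) by (rule continuous_on_compose) (simp add: F(2) factor(1))
  then have "openin (top_of_set X) U"
    unfolding U_def
    by (intro openin_Int openin_coordinate[where f = "\<pi> \<circ> F"] openin_coordinate[where f = \<pi>] factor(1))
  moreover have "x \<in> U" using assms(2) by (simp add: U_def)
  ultimately obtain k where k: "shift_by k \<eta> \<in> U"
    using orbit_meets_open by metis
  have "\<pi> (F (shift_by k \<eta>)) n = (\<pi> (shift_by k \<eta>) n + \<pi> (F \<eta>) n) mod int (p n)"
    using n FX by (simp add: F(4) pi_shift odo_add_nth odo_Delta_nth base_point mod_simps add.commute)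
  moreover have "\<pi> (F (shift_by k \<eta>)) n = \<pi> (F x) n" "\<pi> (shift_by k \<eta>) n = \<pi> x n"
    using k by (simp_all only: U_def Int_iff mem_Collect_eq comp_apply)
  ultimately show "\<pi> (F x) n = odo_add p (\<pi> x) (\<pi> (F \<eta>)) n"
    by (simp only: odo_add_nth[OF n])
qed

lemma odo_nth_mod: "g \<in> odo p \<Longrightarrow> 1 \<le> n \<Longrightarrow> g n mod int (p n) = g n"
  using odo_range[of g n] by simp

lemma odo_add_zero: "y \<in> odo p \<Longrightarrow> odo_add p (odo_Delta p 0) y = y"
  by (rule odo_eqI) (simp_all add: odo_add_nth odo_Delta_nth odo_nth_mod)

lemma y_of_eq:
  assumes "aut F"
  shows "y_of \<eta> p \<pi> F = \<pi> (F \<eta>)"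
  unfolding y_of_def
proof (rule the_equality)
  show "\<pi> (F \<eta>) \<in> odo p \<and> (\<forall>x\<in>topspace (orbit_closure \<eta>). \<pi> (F x) = odo_add p (\<pi> x) (\<pi> (F \<eta>)))"
    using pi_automorphism_base[OF assms] automorphism_in_X[OF assms eta_in_X]
    unfolding topspace_X by (intro conjI pi_odo ballI)
  fix y assume "y \<in> odo p \<and> (\<forall>x\<in>topspace (orbit_closure \<eta>). \<pi> (F x) = odo_add p (\<pi> x) y)"
  then show "y = \<pi> (F \<eta>)"
    using odo_add_zero[of y] by (simp add: base_point)
qed

lemma y_of_odo [simp]: "aut F \<Longrightarrow> y_of \<eta> p \<pi> F \<in> odo p"
  by (simp only: y_of_eq automorphism_in_X eta_in_X pi_odo)

lemma pi_automorphism: "aut F \<Longrightarrow> x \<in> X \<Longrightarrow> \<pi> (F x) = odo_add p (\<pi> x) (y_of \<eta> p \<pi> F)"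
  by (simp only: y_of_eq pi_automorphism_base)

lemma offset_odo [simp]: "aut F \<Longrightarrow> offset F k \<in> odo p"
  by (simp add: offset_def)

lemma offset_nth: "1 \<le> n \<Longrightarrow> offset F k n = (y_of \<eta> p \<pi> F n - k) mod int (p n)"
  by (simp add: offset_def odo_diff_nth odo_Delta_nth mod_simps)

lemma Vk_set_eq:
  assumes "aut F"
  shows "Vk_set \<eta> p (y_of \<eta> p \<pi> F) k = {h \<in> B. odo_add p h (offset F k) \<in> B}"
proof -
  let ?t = "\<lambda>g. odo_diff p (odo_add p g (odo_Delta p k)) (y_of \<eta> p \<pi> F)"
  let ?s = "\<lambda>h. odo_add p h (offset F k)"
  note nth = odo_add_nth odo_diff_nth odo_Delta_nth offset_nth
  have 1: "?t (?s h) = h" if h: "h \<in> odo p" for h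
  proof (rule odo_eqI)
    fix n :: nat assume n: "1 \<le> n"
    have "?t (?s h) n = (h n + (y_of \<eta> p \<pi> F n - k) + k - y_of \<eta> p \<pi> F n) mod int (p n)"
      using n by (simp only: nth mod_simps)
    then show "?t (?s h) n = h n" using odo_nth_mod[OF h n] by simp
  qed (use assms h in auto)
  have 2: "?s (?t g) = g" if g: "g \<in> odo p" for g
  proof (rule odo_eqI)
    fix n :: nat assume n: "1 \<le> n"
    have "?s (?t g) n = (g n + k - y_of \<eta> p \<pi> F n + (y_of \<eta> p \<pi> F n - k)) mod int (p n)"
      using n by (simp only: nth mod_simps)
    then show "?s (?t g) n = g n" using odo_nth_mod[OF g n] by simp
  qed (use assms g in auto)
  show ?thesis
  proof (intro equalityI subsetI)
    fix h assume "h \<in> Vk_set \<eta> p (y_of \<eta> p \<pi> F) k"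
    then obtain g where "h \<in> B" "g \<in> B" "h = ?t g" unfolding Vk_set_def by blast
    then show "h \<in> {h \<in> B. ?s h \<in> B}" using 2[OF B_odo] by simp
  next
    fix h assume "h \<in> {h \<in> B. ?s h \<in> B}"
    then show "h \<in> Vk_set \<eta> p (y_of \<eta> p \<pi> F) k"
      unfolding Vk_set_def using 1[OF B_odo, of h] by (auto intro!: image_eqI[of _ _ "?s h"])
  qed
qed

lemma cylinder_openin: "openin (top_of_set B) {h \<in> B. h N = c}"
proof -
  have "openin (top_of_set B) (B \<inter> {h. h N \<in> {c}})"
    by (intro openin_open_Int open_coordinate)
  moreover have "B \<inter> {h. h N \<in> {c}} = {h \<in> B. h N = c}" by auto
  ultimately show ?thesis by simp
qed

lemma openin_B_cylinder:
  assumes "openin (top_of_set B) U" "g \<in> U"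
  obtains N where "1 \<le> N" "\<And>h. h \<in> B \<Longrightarrow> h N = g N \<Longrightarrow> h \<in> U"
proof -
  obtain T where T: "open T" "U = B \<inter> T" using assms(1) by (auto simp: openin_open)
  then obtain N where "N \<ge> 1" "cylinder p N g \<subseteq> T"
    using open_contains_cylinder[OF toeplitz T(1)] assms(2) B_odo by blast
  then show ?thesis using that T(2) B_odo by (auto simp: cylinder_def)
qed

lemma K_set_iff:
  assumes "aut F"
  shows "k \<in> K_set \<eta> p \<pi> F \<longleftrightarrow>
    (\<exists>g\<in>B. \<exists>N\<ge>1. \<forall>h\<in>B. h N = g N \<longrightarrow> odo_add p h (offset F k) \<in> B)"
proof
  assume "k \<in> K_set \<eta> p \<pi> F"
  then obtain g U where U: "openin (top_of_set B) U" "g \<in> U" "U \<subseteq> {h \<in> B. odo_add p h (offset F k) \<in> B}"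
    by (auto simp: K_set_def Vk_set_eq[OF assms] interior_of_def)
  obtain N where "1 \<le> N" "\<And>h. h \<in> B \<Longrightarrow> h N = g N \<Longrightarrow> h \<in> U"
    using openin_B_cylinder[OF U(1,2)] by blast
  then show "\<exists>g\<in>B. \<exists>N\<ge>1. \<forall>h\<in>B. h N = g N \<longrightarrow> odo_add p h (offset F k) \<in> B"
    using U(2,3) by blast
next
  assume "\<exists>g\<in>B. \<exists>N\<ge>1. \<forall>h\<in>B. h N = g N \<longrightarrow> odo_add p h (offset F k) \<in> B"
  then obtain g N where g: "g \<in> B" "\<And>h. h \<in> B \<Longrightarrow> h N = g N \<Longrightarrow> odo_add p h (offset F k) \<in> B"
    by blast
  have "{h \<in> B. h N = g N} \<subseteq> top_of_set B interior_of Vk_set \<eta> p (y_of \<eta> p \<pi> F) k"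
    by (rule interior_of_maximal) (use g cylinder_openin in \<open>auto simp: Vk_set_eq[OF assms]\<close>)
  then show "k \<in> K_set \<eta> p \<pi> F"
    unfolding K_set_def using g(1) by blast
qed

lemma Baire_translation:
  assumes g: "g \<in> B" "1 \<le> N" and Z: "countable Z" "Z \<subseteq> odo p"
    and cover: "\<And>h. h \<in> B \<Longrightarrow> h N = g N \<Longrightarrow> \<exists>z\<in>Z. odo_add p h z \<in> B"
  obtains z g' N' where "z \<in> Z" "g' \<in> B" "N \<le> N'" "g' N = g N"
    "\<And>h. h \<in> B \<Longrightarrow> h N' = g' N' \<Longrightarrow> odo_add p h z \<in> B"
proof -
  define D where "D = {h \<in> B. h N = g N}"
  define V where "V = (\<lambda>z. {h \<in> D. odo_add p h z \<in> B})"
  have D: "D \<subseteq> B" "openin (top_of_set B) D"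
    unfolding D_def using cylinder_openin by auto
  have "D = B \<inter> {h. h N \<in> {g N}}" by (auto simp: D_def)
  then have "compact D" using compact_Int_closed[OF compact_B closed_coordinate] by metis
  then have "compact_space (top_of_set D)"
    by (simp add: compact_space_subtopology)
  moreover have "Hausdorff_space (top_of_set D)"
    by (intro Hausdorff_space_subtopology Hausdorff_space_discrete_fun)
  ultimately have space: "locally_compact_space (top_of_set D) \<and> regular_space (top_of_set D)"
    by (simp add: compact_imp_locally_compact_space compact_Hausdorff_imp_regular_space)
  have closed: "closedin (top_of_set D) (V z)" if "z \<in> Z" for z
  proof -
    have "z \<in> odo p" using that Z(2) by blast
    then obtain T where T: "closed T" "{h \<in> B. odo_add p h z \<in> B} = B \<inter> T"
      using closedin_translate unfolding closedin_closed by blast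
    have "V z = D \<inter> {h \<in> B. odo_add p h z \<in> B}" using D(1) unfolding V_def by blast
    also have "\<dots> = D \<inter> T" unfolding T(2) using D(1) by blast
    finally show ?thesis using T(1) closedin_closed by blast
  qed
  have "\<exists>z\<in>Z. top_of_set D interior_of V z \<noteq> {}"
  proof (rule ccontr)
    assume "\<not> ?thesis"
    then have "top_of_set D interior_of \<Union>(V ` Z) = {}"
      using closed Z(1) space by (intro Baire_category_alt) auto
    moreover have "\<Union>(V ` Z) = D"
      using cover unfolding V_def D_def by blast
    moreover have "top_of_set D interior_of D = D"
      by (metis interior_of_topspace topspace_euclidean_subtopology)
    moreover have "g \<in> D" using g(1) by (simp add: D_def)
    ultimately show False by auto
  qed
  then obtain z g' where z: "z \<in> Z" "g' \<in> top_of_set D interior_of V z" by blast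
  have "openin (top_of_set B) (top_of_set D interior_of V z)"
    using D(2) openin_interior_of openin_trans by blast
  then obtain M where M: "1 \<le> M" "\<And>h. h \<in> B \<Longrightarrow> h M = g' M \<Longrightarrow> h \<in> top_of_set D interior_of V z"
    using openin_B_cylinder z(2) by blast
  have sub: "top_of_set D interior_of V z \<subseteq> V z" by (rule interior_of_subset)
  then have g': "g' \<in> B" "g' N = g N" using z(2) by (auto simp: V_def D_def)
  show ?thesis
  proof (rule that[OF z(1) g'(1) _ g'(2), of "max N M"])
    fix h assume h: "h \<in> B" "h (max N M) = g' (max N M)"
    then have "h M = g' M"
      using odo_mod[OF toeplitz B_odo[OF h(1)] M(1), of "max N M"]
        odo_mod[OF toeplitz B_odo[OF g'(1)] M(1), of "max N M"] by simp
    then show "odo_add p h z \<in> B"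
      using M(2)[OF h(1)] sub by (auto simp: V_def)
  qed simp
qed

lemma automorphism_cover:
  assumes "aut F" "h \<in> B"
  shows "\<exists>k. odo_add p h (offset F k) \<in> B"
proof -
  note F = automorphism_props[OF assms(1)]
  obtain x where x: "x \<in> X" "\<pi> x = h" "x 0 = True" using fibre_value[OF assms(2)] .
  obtain x' where x': "x' \<in> X" "\<pi> x' = h" "x' 0 = False" using fibre_value[OF assms(2)] .
  have "F x \<noteq> F x'" using F(3) x x' by (auto dest: inj_onD)
  then obtain s where s: "F x s \<noteq> F x' s" by blast
  have "F x \<in> X" "F x' \<in> X" using x(1) x'(1) automorphism_in_X[OF assms(1)] by simp_all
  moreover have "\<pi> (F x) = \<pi> (F x')"
    using pi_automorphism[OF assms(1)] x x' by simp
  ultimately have "odo_add p (\<pi> (F x)) (odo_Delta p s) \<in> B"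
    using s by (intro distinct_values_in_B)
  moreover have "odo_add p (\<pi> (F x)) (odo_Delta p s) = odo_add p h (offset F (- s))"
  proof (rule odo_eqI)
    fix n :: nat assume n: "1 \<le> n"
    have "odo_add p (\<pi> (F x)) (odo_Delta p s) n = (h n + y_of \<eta> p \<pi> F n + s) mod int (p n)"
      using n unfolding pi_automorphism[OF assms(1) x(1)] x(2)
      by (simp only: odo_add_nth odo_Delta_nth mod_simps)
    also have "\<dots> = odo_add p h (offset F (- s)) n"
      using n by (simp only: odo_add_nth offset_nth mod_simps) (simp add: add.assoc)
    finally show "odo_add p (\<pi> (F x)) (odo_Delta p s) n = odo_add p h (offset F (- s)) n" .
  qed (use assms \<open>F x \<in> X\<close> B_odo in auto)
  ultimately show ?thesis by auto
qed

lemma K_set_dense: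
  assumes "aut F" "g \<in> B" "1 \<le> N"
  obtains k g' N' where "k \<in> K_set \<eta> p \<pi> F" "g' \<in> B" "N \<le> N'" "g' N = g N"
    "\<And>h. h \<in> B \<Longrightarrow> h N' = g' N' \<Longrightarrow> odo_add p h (offset F k) \<in> B"
proof -
  obtain z g' N' where z: "z \<in> range (offset F)" "g' \<in> B" "N \<le> N'" "g' N = g N"
    "\<And>h. h \<in> B \<Longrightarrow> h N' = g' N' \<Longrightarrow> odo_add p h z \<in> B"
  proof (rule Baire_translation[OF assms(2,3)])
    show "range (offset F) \<subseteq> odo p" using assms(1) by auto
    show "\<exists>z\<in>range (offset F). odo_add p h z \<in> B" if "h \<in> B" for h
      using automorphism_cover[OF assms(1) that] by blast
  qed auto
  then obtain k where "z = offset F k" by blast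
  moreover from this have "k \<in> K_set \<eta> p \<pi> F"
    using K_set_iff[OF assms(1), of k] z(2,5) le_trans[OF assms(3) z(3)] by blast
  ultimately show ?thesis using that[of k g' N'] z(2-5) by blast
qed

lemma code_cover:
  assumes "aut F" "described_by_code \<eta> F m c" "g \<in> odo p" "odo_add p g (y_of \<eta> p \<pi> F) \<in> B"
  obtains s where "\<bar>s\<bar> \<le> int m" "odo_add p g (odo_Delta p s) \<in> B"
proof -
  note F = automorphism_props[OF assms(1)]
  have lift: "\<exists>x\<in>X. \<pi> x = g \<and> F x 0 = i" for i
  proof -
    obtain w where w: "w \<in> X" "\<pi> w = odo_add p g (y_of \<eta> p \<pi> F)" "w 0 = i"
      by (rule fibre_value[OF assms(4), of i])
    obtain x where x: "x \<in> X" "F x = w" using F(2) w(1) by (metis imageE)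
    have "\<pi> x = g"
    proof (rule odo_eqI)
      fix n :: nat assume n: "1 \<le> n"
      have "(\<pi> x n + y_of \<eta> p \<pi> F n) mod int (p n) = (g n + y_of \<eta> p \<pi> F n) mod int (p n)"
        using pi_automorphism[OF assms(1) x(1)] x(2) w(2) n by (metis odo_add_nth)
      then have "\<pi> x n mod int (p n) = g n mod int (p n)"
        by (metis add_diff_cancel_right' mod_diff_left_eq)
      then show "\<pi> x n = g n"
        using odo_range[OF pi_odo[OF x(1)] n] odo_range[OF assms(3) n] by simp
    qed (use x(1) assms(3) in auto)
    then show ?thesis using x w(3) by blast
  qed
  obtain x where x: "x \<in> X" "\<pi> x = g" "F x 0" using lift[of True] by auto
  obtain x' where x': "x' \<in> X" "\<pi> x' = g" "\<not> F x' 0" using lift[of False] by auto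
  have "\<exists>s\<in>{- int m..int m}. x s \<noteq> x' s"
  proof (rule ccontr)
    assume "\<not> ?thesis"
    then have "restrict (\<lambda>j. x (0 + j)) {- int m..int m} = restrict (\<lambda>j. x' (0 + j)) {- int m..int m}"
      by (intro restrict_ext) simp
    moreover have "F w 0 = c (restrict (\<lambda>j. w (0 + j)) {- int m..int m})" if "w \<in> X" for w
      using assms(2) that unfolding described_by_code_def by simp
    ultimately show False using x x' by metis
  qed
  then obtain s where "s \<in> {- int m..int m}" "x s \<noteq> x' s" by blast
  moreover from this have "\<bar>s\<bar> \<le> int m" by (simp add: abs_le_iff)
  ultimately show ?thesis
    using that[of s] distinct_values_in_B[OF x(1) x'(1)] x(2) x'(2) by metis
qed

lemma automorphism_eq_shift:
  assumes "aut F" "F \<eta> = shift_by k \<eta>" "x \<in> X"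
  shows "F x = shift_by k x"
proof
  fix s
  define U where "U = {w \<in> X. F w s = F x s} \<inter> {w \<in> X. shift_by k w s = shift_by k x s}"
  have "openin (top_of_set X) U"
    unfolding U_def
    by (intro openin_Int openin_coordinate[where f = F] openin_coordinate[where f = "shift_by k"]
        automorphism_props(1)[OF assms(1)] continuous_on_shift_by)
  moreover have "x \<in> U" using assms(3) by (simp add: U_def)
  ultimately obtain j where "shift_by j \<eta> \<in> U"
    using orbit_meets_open by metis
  then have "F (shift_by j \<eta>) s = F x s" "shift_by k (shift_by j \<eta>) s = shift_by k x s"
    unfolding U_def by blast+
  moreover have "F (shift_by j \<eta>) = shift_by k (shift_by j \<eta>)"
    by (simp add: automorphism_props(4)[OF assms(1)] assms(2) shift_by_add add.commute)
  ultimately show "F x s = shift_by k x s" by metis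
qed

lemma singleton_K_set_translation:
  assumes "aut F" "K_set \<eta> p \<pi> F = {k}" "h \<in> B"
  shows "odo_add p h (offset F k) \<in> B"
proof (rule ccontr)
  assume "odo_add p h (offset F k) \<notin> B"
  then obtain n where n: "1 \<le> n" "odo_add p h (offset F k) n \<notin> holes \<eta> p n"
    using assms(1) B_odo[OF assms(3)] by (auto simp: B_iff)
  obtain k' g N where g: "k' \<in> K_set \<eta> p \<pi> F" "g \<in> B" "n \<le> N" "g n = h n"
    "\<And>h. h \<in> B \<Longrightarrow> h N = g N \<Longrightarrow> odo_add p h (offset F k') \<in> B"
    by (rule K_set_dense[OF assms(1,3) n(1)]) (rule that)
  have "odo_add p g (offset F k) \<in> B" using g(1,2,5) assms(2) by simp
  then have "odo_add p g (offset F k) n \<in> holes \<eta> p n" using n(1) by (simp add: B_iff)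
  then show False using n g(4) by (simp add: odo_add_nth)
qed

lemma singleton_K_set_period:
  assumes "aut F" "K_set \<eta> p \<pi> F = {k}" "1 \<le> n"
  shows "odo_dvd (p n) (minimal_period (essential_holes \<eta> p n)) (y_of \<eta> p \<pi> F n - k)"
proof -
  let ?H = "essential_holes \<eta> p n" and ?z = "offset F k n"
  have fwd: "i + ?z \<in> ?H" if i: "i \<in> ?H" for i
  proof -
    obtain g where g: "g \<in> B" "g n = i mod int (p n)"
      using i unfolding essential_holes_iff[OF assms(3)] by blast
    have "odo_add p g (offset F k) n \<in> ?H"
      using singleton_K_set_translation[OF assms(1,2) g(1)] assms(3) by (rule essential_holes_nth)
    moreover have "[odo_add p g (offset F k) n = i + ?z] (mod int (p n))"
      using assms(3) by (simp add: odo_add_nth g(2) cong_def mod_simps)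
    ultimately show ?thesis using essential_holes_cong[OF assms(3)] by blast
  qed
  have iterate: "i + int j * ?z \<in> ?H" if "i \<in> ?H" for i j
  proof (induction j)
    case (Suc j)
    then show ?case using fwd[of "i + int j * ?z"] by (simp add: algebra_simps)
  qed (use that in simp)
  have "int (minimal_period ?H) dvd ?z"
  proof (rule minimal_period_dvd)
    show "0 < p n" using p_pos assms(3) .
    show "i + int (p n) \<in> ?H \<longleftrightarrow> i \<in> ?H" for i
      using assms(3) by (intro essential_holes_cong) (simp_all add: cong_def)
    show "i + ?z \<in> ?H \<longleftrightarrow> i \<in> ?H" for i
    proof
      assume "i + ?z \<in> ?H"
      then have "i + ?z + int (p n - 1) * ?z \<in> ?H" by (rule iterate)
      also have "i + ?z + int (p n - 1) * ?z = i + int (p n) * ?z"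
        using p_pos[OF assms(3)] by (simp add: algebra_simps)
      finally show "i \<in> ?H"
        using essential_holes_cong[OF assms(3), of "i + int (p n) * ?z" i] by (simp add: cong_def)
    qed (rule fwd)
  qed
  then obtain w where "?z = int (minimal_period ?H) * w" by blast
  moreover have "[y_of \<eta> p \<pi> F n - k = ?z] (mod int (p n))"
    using assms(3) by (simp add: offset_nth cong_def)
  ultimately show ?thesis unfolding odo_dvd_def by auto
qed

lemma trivial_centralizer_if_singleton:
  assumes K: "\<And>F. aut F \<Longrightarrow> card (K_set \<eta> p \<pi> F) = 1"
    and period: "\<And>n. 1 \<le> n \<Longrightarrow> minimal_period (essential_holes \<eta> p n) = p n"
  shows "trivial_centralizer \<eta>"
  unfolding trivial_centralizer_def
proof (intro allI impI)
  fix F assume F: "aut F"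
  obtain k where k: "K_set \<eta> p \<pi> F = {k}" using K[OF F] by (auto simp: card_1_singleton_iff)
  have "\<pi> (F \<eta>) = odo_Delta p k"
  proof (rule odo_eqI)
    fix n :: nat assume n: "1 \<le> n"
    have "odo_dvd (p n) (p n) (y_of \<eta> p \<pi> F n - k)"
      using singleton_K_set_period[OF F k n] period[OF n] by simp
    then have "y_of \<eta> p \<pi> F n mod int (p n) = k mod int (p n)"
      by (simp add: odo_dvd_iff mod_eq_dvd_iff)
    then show "\<pi> (F \<eta>) n = odo_Delta p k n"
      using n odo_nth_mod[OF y_of_odo[OF F] n] by (simp add: odo_Delta_nth y_of_eq[OF F])
  qed (simp_all add: automorphism_in_X[OF F])
  then have "F \<eta> = shift_by k \<eta>"
    by (rule fibre_over_Delta[OF automorphism_in_X[OF F eta_in_X]])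
  then show "\<exists>k. \<forall>x\<in>topspace (orbit_closure \<eta>). F x = shift_by k x"
    using automorphism_eq_shift[OF F] unfolding topspace_X by blast
qed

end

section \<open>The set of integers attached to an automorphism\<close>

locale sparse_toeplitz = toeplitz_odometer +
  fixes A :: "nat \<Rightarrow> nat set" and S :: "nat \<Rightarrow> nat \<Rightarrow> nat set"
  assumes A_pos: "\<And>n. n \<ge> 1 \<Longrightarrow> A n \<subseteq> {0<..}"
    and A_primitive: "\<And>n. n \<ge> 1 \<Longrightarrow> primitive (A n)"
    and holes_eq: "\<And>n. n \<ge> 1 \<Longrightarrow>
       essential_holes \<eta> p n = (\<Union>a\<in>A n. {z. int a dvd z} - multiples (S n a))"
    and nonempty: "\<And>n a. n \<ge> 1 \<Longrightarrow> a \<in> A n \<Longrightarrow> {z. int a dvd z} - multiples (S n a) \<noteq> {}"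
    and totient_sums: "\<And>\<alpha>. (\<And>n. n \<ge> 1 \<Longrightarrow> \<alpha> n \<in> A n) \<Longrightarrow>
       (\<lambda>n. \<Sum>\<^sub>\<infinity>a'\<in>A n - {\<alpha> n}. ennreal (1 / real (totient (a' div gcd a' (\<alpha> n)))))
         \<longlonglongrightarrow> 0"
begin

lemma level:
  assumes "1 \<le> n"
  shows "periodic_multiples (essential_holes \<eta> p n) (A n) (S n) (p n)"
proof
  show "k + int (p n) \<in> essential_holes \<eta> p n \<longleftrightarrow> k \<in> essential_holes \<eta> p n" for k
    using assms by (intro essential_holes_cong) (simp_all add: cong_def)
qed (fact p_pos[OF assms] A_pos[OF assms] A_primitive[OF assms] holes_eq[OF assms] nonempty[OF assms])+

lemmas A_dvd_p = periodic_multiples.dvd_period[OF level]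
lemmas A_in_holes = periodic_multiples.A_subset[OF level]

lemma A_coarser:
  assumes "1 \<le> n" "n \<le> n'" "a' \<in> A n'"
  obtains a where "a \<in> A n" "a dvd a'"
proof -
  have "int a' \<in> essential_holes \<eta> p n"
    using assms A_in_holes[of n' a'] essential_holes_antimono[of n n'] by auto
  then show ?thesis
    using periodic_multiples.interval_below[OF level[OF assms(1)]] that by (metis int_dvd_int_iff)
qed

lemma A_dvd_nth:
  assumes "1 \<le> n" "n \<le> n'" "a \<in> A n" "g \<in> odo p" "int a dvd g n'"
  shows "int a dvd g n"
proof -
  have "int a dvd int (p n)" using A_dvd_p[OF assms(1,3)] by simp
  then show ?thesis
    using assms(5) odo_mod[OF toeplitz assms(4,1,2)] by (metis dvd_mod_iff)
qed

lemma A_large: "\<exists>n\<ge>1. \<forall>a\<in>A n. L < a"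
proof -
  have "\<forall>a. \<exists>n0. \<forall>n\<ge>n0. int a \<notin> essential_holes \<eta> p n"
    using essential_holes_eventually by (rule allI)
  then obtain n0 where n0: "\<And>a n. n0 a \<le> n \<Longrightarrow> int a \<notin> essential_holes \<eta> p n"
    unfolding choice_iff by (elim exE) blast
  define n where "n = Max (insert 1 (n0 ` {..L}))"
  have n: "1 \<le> n" "\<And>a. a \<le> L \<Longrightarrow> n0 a \<le> n"
    unfolding n_def by (rule Max_ge; simp)+
  have "L < a" if "a \<in> A n" for a
    using A_in_holes[OF n(1) that] n0 n(2) by (meson not_le)
  then show ?thesis using n(1) by blast
qed

lemma A_nonempty:
  assumes "1 \<le> n"
  shows "A n \<noteq> {}"
proof -
  obtain g where "g \<in> B" using B_nonempty by blast
  then have "g n \<in> essential_holes \<eta> p n" using assms by (rule essential_holes_nth)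
  then show ?thesis
    using periodic_multiples.interval_below[OF level[OF assms]] by (metis empty_iff)
qed

lemma totient_sum_small:
  assumes "\<And>n. n \<ge> 1 \<Longrightarrow> \<alpha> n \<in> A n" "\<epsilon> > 0"
  shows "\<exists>n0. \<forall>n\<ge>n0. 1 \<le> n \<longrightarrow> (\<Sum>a'\<in>A n - {\<alpha> n}. 1 / real (totient (a' div gcd a' (\<alpha> n)))) < \<epsilon>"
proof -
  have "\<forall>\<^sub>F n in sequentially.
      (\<Sum>\<^sub>\<infinity>a'\<in>A n - {\<alpha> n}. ennreal (1 / real (totient (a' div gcd a' (\<alpha> n))))) < ennreal \<epsilon>"
    using totient_sums[of \<alpha>] assms by (intro order_tendstoD(2)[where y = 0]) auto
  then obtain n0 where n0: "\<And>n. n \<ge> n0 \<Longrightarrow>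
      (\<Sum>\<^sub>\<infinity>a'\<in>A n - {\<alpha> n}. ennreal (1 / real (totient (a' div gcd a' (\<alpha> n))))) < ennreal \<epsilon>"
    unfolding eventually_sequentially by blast
  have "(\<Sum>a'\<in>A n - {\<alpha> n}. 1 / real (totient (a' div gcd a' (\<alpha> n)))) < \<epsilon>" if "n0 \<le> n" "1 \<le> n" for n
  proof -
    have "finite (A n - {\<alpha> n})" using periodic_multiples.finite_A[OF level[OF that(2)]] by simp
    then have "ennreal (\<Sum>a'\<in>A n - {\<alpha> n}. 1 / real (totient (a' div gcd a' (\<alpha> n)))) < ennreal \<epsilon>"
      using n0[OF that(1)] by simp
    then show ?thesis by (subst (asm) ennreal_less_iff) (auto intro: sum_nonneg)
  qed
  then show ?thesis by blast
qed

lemma translation_dvd: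
  assumes z: "z \<in> odo p" and g: "g \<in> B" and N: "1 \<le> N"
    and trans: "\<And>h. h \<in> B \<Longrightarrow> h N = g N \<Longrightarrow> odo_add p h z \<in> B"
    and n: "1 \<le> n"
  shows "\<exists>a\<in>A n. int a dvd g n \<and> int a dvd z n"
proof -
  have "\<exists>a\<in>A n. int a dvd g n \<and> (\<forall>x. int a dvd x \<longrightarrow> x dvd g n \<longrightarrow> x \<in> essential_holes \<eta> p n)"
    if "1 \<le> n" for n
    using periodic_multiples.interval_below[OF level[OF that] essential_holes_nth[OF g that]] by metis
  then obtain \<alpha> where \<alpha>: "\<And>n. 1 \<le> n \<Longrightarrow> \<alpha> n \<in> A n" "\<And>n. 1 \<le> n \<Longrightarrow> int (\<alpha> n) dvd g n"
    "\<And>n x. 1 \<le> n \<Longrightarrow> int (\<alpha> n) dvd x \<Longrightarrow> x dvd g n \<Longrightarrow> x \<in> essential_holes \<eta> p n"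
    by metis
  have "1 / (real (p N))\<^sup>2 > 0" using p_pos[OF N] by simp
  then obtain n0 where n0: "\<And>n. n0 \<le> n \<Longrightarrow> 1 \<le> n \<Longrightarrow>
      (\<Sum>a'\<in>A n - {\<alpha> n}. 1 / real (totient (a' div gcd a' (\<alpha> n)))) < 1 / (real (p N))\<^sup>2"
    using totient_sum_small[of \<alpha>, OF \<alpha>(1)] by blast
  define M where "M = Max {n, N, n0}"
  have M: "n \<le> M" "N \<le> M" "n0 \<le> M" "1 \<le> M" using N by (auto simp: M_def)
  interpret M: periodic_multiples "essential_holes \<eta> p M" "A M" "S M" "p M"
    by (rule level[OF M(4)])
  define h where "h = nat (g M)"
  have h: "int h = g M" using odo_range[OF B_odo[OF g] M(4)] by (simp add: h_def)
  have "int (\<alpha> M) dvd z M"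
  proof (rule M.dvd_translation[where h = h and N = "p N"])
    show "\<alpha> M \<in> A M" using \<alpha>(1) M(4) .
    show "\<alpha> M dvd h" using \<alpha>(2)[OF M(4)] by (simp flip: h)
    show "int x \<in> essential_holes \<eta> p M" if "\<alpha> M dvd x" "x dvd h" for x
      using \<alpha>(3)[OF M(4)] that by (simp flip: h)
    show "p N dvd p M" using p_dvd N M(2) .
    show "(\<Sum>a'\<in>A M - {\<alpha> M}. 1 / real (totient (a' div gcd a' (\<alpha> M)))) < 1 / (real (p N))\<^sup>2"
      using n0 M(3,4) .
    fix h' assume h': "int h' \<in> essential_holes \<eta> p M" "[h' = h] (mod p N)"
    then obtain g' where g': "g' \<in> B" "g' M = int h' mod int (p M)"
      using essential_holes_iff[OF M(4)] by blast
    have "g' N = int h' mod int (p N)"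
      using odo_mod[OF toeplitz B_odo[OF g'(1)] N M(2)] g'(2) p_dvd[OF N M(2)]
      by (simp add: mod_mod_cancel)
    also have "\<dots> = int h mod int (p N)"
      using h'(2) by (simp add: cong_def flip: zmod_int)
    also have "\<dots> = g N"
      unfolding h using odo_mod[OF toeplitz B_odo[OF g] N M(2)] .
    finally have "odo_add p g' z M \<in> essential_holes \<eta> p M"
      using trans[OF g'(1)] essential_holes_nth M(4) by blast
    moreover have "[odo_add p g' z M = int h' + z M] (mod int (p M))"
      using M(4) by (simp add: odo_add_nth g'(2) cong_def mod_simps)
    ultimately have "int h' + z M \<in> essential_holes \<eta> p M" using M.cong_mem by blast
    then show "\<exists>a'\<in>A M. int a' dvd int h' + z M"
      using M.interval_below by metis
  qed
  moreover obtain a where a: "a \<in> A n" "a dvd \<alpha> M"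
    using A_coarser[OF n M(1) \<alpha>(1)[OF M(4)]] .
  ultimately have "int a dvd z M" "int a dvd g M"
    using \<alpha>(2)[OF M(4)] by (meson dvd_trans int_dvd_int_iff)+
  then show ?thesis
    using a(1) A_dvd_nth[OF n M(1) a(1)] z B_odo[OF g] by blast
qed

lemma A_dvd_offset_iff:
  assumes "1 \<le> n" "a \<in> A n"
  shows "int a dvd offset F k n \<longleftrightarrow> odo_dvd (p n) a (y_of \<eta> p \<pi> F n - k)"
  using A_dvd_p[OF assms] assms(1) by (simp add: offset_nth odo_dvd_iff dvd_mod_iff)

lemma K_set_dvd:
  assumes "aut F" "k \<in> K_set \<eta> p \<pi> F" "1 \<le> n"
  shows "\<exists>a\<in>A n. odo_dvd (p n) a (y_of \<eta> p \<pi> F n - k)"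
proof -
  obtain g N where g: "g \<in> B" "1 \<le> N"
    "\<And>h. h \<in> B \<Longrightarrow> h N = g N \<Longrightarrow> odo_add p h (offset F k) \<in> B"
    using assms(2) unfolding K_set_iff[OF assms(1)] by blast
  then show ?thesis
    using translation_dvd[OF offset_odo[OF assms(1)] g assms(3)] A_dvd_offset_iff[OF assms(3)] by blast
qed

lemma K_set_exists:
  assumes "aut F" "1 \<le> n" "a \<in> A n"
  shows "\<exists>k\<in>K_set \<eta> p \<pi> F. odo_dvd (p n) a (y_of \<eta> p \<pi> F n - k)"
proof -
  obtain g where g: "g \<in> B" "g n = int a mod int (p n)"
    using A_in_holes[OF assms(2,3)] essential_holes_iff[OF assms(2)] by blast
  obtain k g' N where k: "k \<in> K_set \<eta> p \<pi> F" "g' \<in> B" "n \<le> N" "g' n = g n"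
    "\<And>h. h \<in> B \<Longrightarrow> h N = g' N \<Longrightarrow> odo_add p h (offset F k) \<in> B"
    by (rule K_set_dense[OF assms(1) g(1) assms(2)]) (rule that)
  obtain b where b: "b \<in> A n" "int b dvd g' n" "int b dvd offset F k n"
    using translation_dvd[OF offset_odo[OF assms(1)] k(2) le_trans[OF assms(2) k(3)] k(5) assms(2)] by blast
  have "int b dvd int (p n)" using A_dvd_p[OF assms(2) b(1)] by simp
  then have "int b dvd int a" using b(2) k(4) g(2) by (simp add: dvd_mod_iff)
  then have "b = a"
    using A_primitive[OF assms(2)] b(1) assms(3) unfolding primitive_def by simp
  then show ?thesis using k(1) b(3) A_dvd_offset_iff[OF assms(2,3)] by blast
qed

lemma translation_by_integer_zero:
  assumes "g \<in> B" "1 \<le> N" "\<And>h. h \<in> B \<Longrightarrow> h N = g N \<Longrightarrow> odo_add p h (odo_Delta p j) \<in> B"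
  shows "j = 0"
proof (rule ccontr)
  assume "j \<noteq> 0"
  obtain n where n: "1 \<le> n" "\<And>a. a \<in> A n \<Longrightarrow> nat \<bar>j\<bar> < a" using A_large by blast
  obtain a where a: "a \<in> A n" "int a dvd odo_Delta p j n"
    using translation_dvd[OF Delta_odo assms n(1)] by blast
  moreover have "int a dvd int (p n)" using A_dvd_p[OF n(1) a(1)] by simp
  ultimately have "int a dvd j" using n(1) by (simp add: odo_Delta_nth dvd_mod_iff)
  then have "\<bar>int a\<bar> \<le> \<bar>j\<bar>" using \<open>j \<noteq> 0\<close> by (rule dvd_imp_le_int[rotated])
  then show False using n(2)[OF a(1)] by linarith
qed

lemma K_set_bounded:
  assumes "aut F" "described_by_code \<eta> F m c" "k \<in> K_set \<eta> p \<pi> F"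
  shows "\<bar>k\<bar> \<le> int m"
proof -
  obtain g N where g: "g \<in> B" "1 \<le> N"
    "\<And>h. h \<in> B \<Longrightarrow> h N = g N \<Longrightarrow> odo_add p h (offset F k) \<in> B"
    using assms(3) unfolding K_set_iff[OF assms(1)] by blast
  define Z where "Z = (\<lambda>s. odo_Delta p (s - k)) ` {- int m..int m}"
  have cover: "\<exists>z\<in>Z. odo_add p h z \<in> B" if h: "h \<in> B" "h N = g N" for h
  proof -
    let ?h = "odo_diff p h (odo_Delta p k)"
    have "odo_add p ?h (y_of \<eta> p \<pi> F) = odo_add p h (offset F k)"
    proof (rule odo_eqI)
      fix n :: nat assume n: "1 \<le> n"
      have "odo_add p ?h (y_of \<eta> p \<pi> F) n = (h n - k + y_of \<eta> p \<pi> F n) mod int (p n)"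
        using n by (simp only: odo_add_nth odo_diff_nth odo_Delta_nth mod_simps)
      also have "\<dots> = odo_add p h (offset F k) n"
        using n by (simp only: odo_add_nth offset_nth mod_simps) (simp add: algebra_simps)
      finally show "odo_add p ?h (y_of \<eta> p \<pi> F) n = odo_add p h (offset F k) n" .
    qed (use assms(1) B_odo[OF h(1)] in auto)
    then have mem: "odo_add p ?h (y_of \<eta> p \<pi> F) \<in> B" using g(3)[OF h] by simp
    have hodo: "?h \<in> odo p" using B_odo[OF h(1)] by simp
    obtain s where s: "\<bar>s\<bar> \<le> int m" "odo_add p ?h (odo_Delta p s) \<in> B"
      using code_cover[OF assms(1,2) hodo mem] .
    have "odo_add p ?h (odo_Delta p s) = odo_add p h (odo_Delta p (s - k))"
    proof (rule odo_eqI)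
      fix n :: nat assume n: "1 \<le> n"
      have "odo_add p ?h (odo_Delta p s) n = (h n - k + s) mod int (p n)"
        using n by (simp only: odo_add_nth odo_diff_nth odo_Delta_nth mod_simps)
      also have "\<dots> = odo_add p h (odo_Delta p (s - k)) n"
        using n by (simp only: odo_add_nth odo_Delta_nth mod_simps) (simp add: algebra_simps)
      finally show "odo_add p ?h (odo_Delta p s) n = odo_add p h (odo_Delta p (s - k)) n" .
    qed (use B_odo[OF h(1)] in auto)
    then show ?thesis
      unfolding Z_def using s by (intro bexI[of _ "odo_Delta p (s - k)"] image_eqI[of _ _ s]) auto
  qed
  have Z: "countable Z" "Z \<subseteq> odo p" by (auto simp: Z_def)
  obtain z g' N' where z: "z \<in> Z" "g' \<in> B" "N \<le> N'"
    "\<And>h. h \<in> B \<Longrightarrow> h N' = g' N' \<Longrightarrow> odo_add p h z \<in> B"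
    using Baire_translation[OF g(1,2) Z cover] by metis
  then obtain s where s: "s \<in> {- int m..int m}" "z = odo_Delta p (s - k)" unfolding Z_def by blast
  then have "s - k = 0"
    using translation_by_integer_zero[OF z(2) le_trans[OF g(2) z(3)]] z(4) by blast
  then show ?thesis using s(1) by (simp add: abs_le_iff)
qed

lemma K_set_eq_of_dvd:
  assumes "aut F" "described_by_code \<eta> F m c" "1 \<le> n"
    and "a \<in> A n" "a' \<in> A n" "2 * m < gcd a a'"
    and "k \<in> K_set \<eta> p \<pi> F" "odo_dvd (p n) a (y_of \<eta> p \<pi> F n - k)"
    and "k' \<in> K_set \<eta> p \<pi> F" "odo_dvd (p n) a' (y_of \<eta> p \<pi> F n - k')"
  shows "k = k'"
proof (rule ccontr)
  assume "k \<noteq> k'"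
  have dvd: "int a dvd y_of \<eta> p \<pi> F n - k" "int a' dvd y_of \<eta> p \<pi> F n - k'"
    using assms(8,10) A_dvd_p[OF assms(3)] assms(4,5) by (simp_all add: odo_dvd_iff)
  have "int (gcd a a') dvd (y_of \<eta> p \<pi> F n - k') - (y_of \<eta> p \<pi> F n - k)"
    by (rule dvd_diff[OF dvd_trans[OF _ dvd(2)] dvd_trans[OF _ dvd(1)]]) simp_all
  then have "\<bar>int (gcd a a')\<bar> \<le> \<bar>k - k'\<bar>"
    using \<open>k \<noteq> k'\<close> by (intro dvd_imp_le_int) auto
  moreover have "\<bar>k\<bar> \<le> int m" "\<bar>k'\<bar> \<le> int m"
    using K_set_bounded[OF assms(1,2)] assms(7,9) by blast+
  ultimately show False using assms(6) by linarith
qed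

lemma K_set_unique:
  assumes "aut F" "described_by_code \<eta> F m c" "1 \<le> n" "a \<in> A n" "2 * m < a"
  shows "\<exists>!k. k \<in> K_set \<eta> p \<pi> F \<and> odo_dvd (p n) a (y_of \<eta> p \<pi> F n - k)"
  using K_set_exists[OF assms(1,3,4)] K_set_eq_of_dvd[OF assms(1-4,4)] assms(5) by auto

lemma kappa_props:
  assumes "aut F" "described_by_code \<eta> F m c" "1 \<le> n" "a \<in> A n" "2 * m < a"
  shows "kappa \<eta> p \<pi> F n a \<in> K_set \<eta> p \<pi> F"
    and "odo_dvd (p n) a (y_of \<eta> p \<pi> F n - kappa \<eta> p \<pi> F n a)"
    and "k \<in> K_set \<eta> p \<pi> F \<Longrightarrow> odo_dvd (p n) a (y_of \<eta> p \<pi> F n - k) \<Longrightarrow> kappa \<eta> p \<pi> F n a = k"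
  using theI'[OF K_set_unique[OF assms]] the1_equality[OF K_set_unique[OF assms]]
  unfolding kappa_def by blast+

lemma kappa_connected:
  assumes "aut F" "described_by_code \<eta> F m c" "1 \<le> n" "\<forall>a\<in>A n. 2 * m < a"
    and "a \<in> A n" "(a, a') \<in> (gcd_edges (A n) m)\<^sup>*"
  shows "kappa \<eta> p \<pi> F n a = kappa \<eta> p \<pi> F n a'"
  using assms(6)
proof (induction rule: rtrancl_induct)
  case (step b b')
  then have b: "b \<in> A n" "b' \<in> A n" "2 * m < gcd b b'" by (auto simp: gcd_edges_def)
  have large: "2 * m < b" "2 * m < b'" using assms(4) b by auto
  have "kappa \<eta> p \<pi> F n b = kappa \<eta> p \<pi> F n b'"
    by (rule K_set_eq_of_dvd[OF assms(1-3) b])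
       (intro kappa_props[OF assms(1-3) b(1) large(1)] kappa_props[OF assms(1-3) b(2) large(2)])+
  then show ?case using step by simp
qed simp

lemma card_K_set_connected:
  assumes "aut F" "described_by_code \<eta> F m c" "1 \<le> n" "\<forall>a\<in>A n. 2 * m < a"
    and "\<forall>a\<in>A n. \<forall>a'\<in>A n. (a, a') \<in> (gcd_edges (A n) m)\<^sup>*"
  shows "card (K_set \<eta> p \<pi> F) = 1"
proof -
  obtain a where a: "a \<in> A n" using A_nonempty[OF assms(3)] by blast
  have "k = kappa \<eta> p \<pi> F n a" if k: "k \<in> K_set \<eta> p \<pi> F" for k
  proof -
    obtain b where b: "b \<in> A n" "odo_dvd (p n) b (y_of \<eta> p \<pi> F n - k)"
      using K_set_dvd[OF assms(1) k assms(3)] by blast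
    have "kappa \<eta> p \<pi> F n b = k"
      using kappa_props(3)[OF assms(1-3) b(1) _ k b(2)] assms(4) b(1) by blast
    then show ?thesis using kappa_connected[OF assms(1-4) a] assms(5) a b(1) by metis
  qed
  moreover have "kappa \<eta> p \<pi> F n a \<in> K_set \<eta> p \<pi> F"
    using kappa_props(1)[OF assms(1-3) a] assms(4) a by blast
  ultimately have "K_set \<eta> p \<pi> F = {kappa \<eta> p \<pi> F n a}" by blast
  then show ?thesis by simp
qed

end

theorem theorem2p31:
  fixes \<eta> :: "int \<Rightarrow> bool" and p :: "nat \<Rightarrow> nat"
    and \<pi> :: "(int \<Rightarrow> bool) \<Rightarrow> (nat \<Rightarrow> int)"
    and A :: "nat \<Rightarrow> nat set" and S :: "nat \<Rightarrow> nat \<Rightarrow> nat set"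
    and F :: "(int \<Rightarrow> bool) \<Rightarrow> (int \<Rightarrow> bool)" and m :: nat and c :: "(int \<Rightarrow> bool) \<Rightarrow> bool"
  defines "y \<equiv> y_of \<eta> p \<pi> F" and "K \<equiv> K_set \<eta> p \<pi> F"
    and "\<tau> \<equiv> (\<lambda>n. minimal_period (essential_holes \<eta> p n))"
  assumes toeplitz: "toeplitz \<eta> p"
    and mef: "max_equicontinuous_factor (orbit_closure \<eta>) shift (top_of_set (odo p)) (odo_T p) \<pi>"
    and base_point: "\<pi> \<eta> = odo_Delta p 0"
    and A_pos: "\<And>n. n \<ge> 1 \<Longrightarrow> A n \<subseteq> {0<..}"
    and A_primitive: "\<And>n. n \<ge> 1 \<Longrightarrow> primitive (A n)"
    and S_pos: "\<And>n a. n \<ge> 1 \<Longrightarrow> a \<in> A n \<Longrightarrow> S n a \<subseteq> {0<..}"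
    and holes_eq: "\<And>n. n \<ge> 1 \<Longrightarrow>
       essential_holes \<eta> p n = (\<Union>a\<in>A n. {z. int a dvd z} - multiples (S n a))"
    and nonempty: "\<And>n a. n \<ge> 1 \<Longrightarrow> a \<in> A n \<Longrightarrow> {z. int a dvd z} - multiples (S n a) \<noteq> {}"
    and totient_sums: "\<And>\<alpha>. (\<And>n. n \<ge> 1 \<Longrightarrow> \<alpha> n \<in> A n) \<Longrightarrow>
       (\<lambda>n. \<Sum>\<^sub>\<infinity>a'\<in>A n - {\<alpha> n}. ennreal (1 / real (totient (a' div gcd a' (\<alpha> n)))))
         \<longlonglongrightarrow> 0"
    and automorphism: "automorphism (orbit_closure \<eta>) shift F"
    and code: "described_by_code \<eta> F m c"
  shows
    \<comment> \<open>(a)\<close>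
    "(\<forall>n\<ge>1. \<forall>k\<in>K. \<exists>a\<in>A n. odo_dvd (p n) a (y n - k)) \<and>
    \<comment> \<open>(b)\<close>
     (\<forall>n\<ge>1. \<forall>a\<in>A n.
        (\<exists>k\<in>K. odo_dvd (p n) a (y n - k)) \<and>
        (a > 2 * m \<longrightarrow> (\<exists>!k. k \<in> K \<and> odo_dvd (p n) a (y n - k)))) \<and>
    \<comment> \<open>(c)\<close>
     (\<forall>n\<ge>1. (\<forall>a\<in>A n. a > 2 * m) \<longrightarrow>
        (\<forall>a\<in>A n. \<forall>a'\<in>A n. (a, a') \<in> (gcd_edges (A n) m)\<^sup>* \<longrightarrow>
           kappa \<eta> p \<pi> F n a = kappa \<eta> p \<pi> F n a') \<and>
        ((\<forall>a\<in>A n. \<forall>a'\<in>A n. (a, a') \<in> (gcd_edges (A n) m)\<^sup>*) \<longrightarrow> card K = 1)) \<and>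
    \<comment> \<open>(d)\<close>
     (\<forall>k. K = {k} \<longrightarrow> (\<forall>n\<ge>1. odo_dvd (p n) (\<tau> n) (y n - k))) \<and>
    \<comment> \<open>(e)\<close>
     ((\<forall>F'. automorphism (orbit_closure \<eta>) shift F' \<longrightarrow> card (K_set \<eta> p \<pi> F') = 1) \<and>
      (\<forall>n\<ge>1. \<tau> n = p n) \<longrightarrow> trivial_centralizer \<eta>)"
proof -
  interpret sparse_toeplitz \<eta> p \<pi> A S
    by unfold_locales (fact toeplitz mef base_point A_pos A_primitive holes_eq nonempty totient_sums)+
  show ?thesis
    unfolding y_def K_def \<tau>_def
  proof (intro conjI allI ballI impI)
    fix n :: nat and k assume "1 \<le> n" "k \<in> K_set \<eta> p \<pi> F"
    then show "\<exists>a\<in>A n. odo_dvd (p n) a (y_of \<eta> p \<pi> F n - k)"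
      using K_set_dvd[OF automorphism] by blast
  next
    fix n :: nat and a assume "1 \<le> n" "a \<in> A n"
    then show "\<exists>k\<in>K_set \<eta> p \<pi> F. odo_dvd (p n) a (y_of \<eta> p \<pi> F n - k)"
      using K_set_exists[OF automorphism] by blast
  next
    fix n :: nat and a assume "1 \<le> n" "a \<in> A n" "2 * m < a"
    then show "\<exists>!k. k \<in> K_set \<eta> p \<pi> F \<and> odo_dvd (p n) a (y_of \<eta> p \<pi> F n - k)"
      using K_set_unique[OF automorphism code] by blast
  next
    fix n :: nat and a a' assume "1 \<le> n" "\<forall>a\<in>A n. 2 * m < a" "a \<in> A n" "(a, a') \<in> (gcd_edges (A n) m)\<^sup>*"
    then show "kappa \<eta> p \<pi> F n a = kappa \<eta> p \<pi> F n a'"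
      using kappa_connected[OF automorphism code] by blast
  next
    fix n :: nat assume "1 \<le> n" "\<forall>a\<in>A n. 2 * m < a"
      "\<forall>a\<in>A n. \<forall>a'\<in>A n. (a, a') \<in> (gcd_edges (A n) m)\<^sup>*"
    then show "card (K_set \<eta> p \<pi> F) = 1"
      using card_K_set_connected[OF automorphism code] by blast
  next
    fix k and n :: nat assume "K_set \<eta> p \<pi> F = {k}" "1 \<le> n"
    then show "odo_dvd (p n) (minimal_period (essential_holes \<eta> p n)) (y_of \<eta> p \<pi> F n - k)"
      by (rule singleton_K_set_period[OF automorphism])
  next
    assume "(\<forall>F'. aut F' \<longrightarrow> card (K_set \<eta> p \<pi> F') = 1) \<and>
      (\<forall>n\<ge>1. minimal_period (essential_holes \<eta> p n) = p n)"
    then show "trivial_centralizer \<eta>"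
      by (intro trivial_centralizer_if_singleton) blast+
  qed
qed

end
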